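(* Let $3 \leq p \leq q$ be integers. Then $K_{p,q}^+$ is not determined by its spectrum if and only if the quadratic equation $x^2-(q+3)x+(pq+2)=0$ has two integral roots $p''\leq q''$ lying in $[2,\infty)$. Moreover, if $K_{p,q}^+$ is not determined by its spectrum, then $K_{p'',q''}^- \cup (p-2)K_1$ (the disjoint union of $K_{p'',q''}^-$ and $p-2$ isolated vertices) is the unique graph, up to isomorphism, that is cospectral with $K_{p,q}^+$ but not isomorphic to it.
   Context: All graphs are finite and simple. The spectrum of a graph is the multiset of eigenvalues of its adjacency matrix; two graphs are cospectral if they have the same spectrum, and a graph $G$ is determined by its spectrum if every graph cospectral with $G$ is isomorphic to $G$. $K_{p,q}$ denotes the complete bipartite graph with parts of sizes $p$ and $q$, and $K_1$ is a single vertex. For $2 \leq \min\{p,q\}$, $K_{p,q}^-$ denotes the graph obtained from $K_{p,q}$ by deleting one edge, and $K_{p,q}^+$ denotes the graph obtained from $K_{p,q}$ by adding a new vertex $x$ and a new edge $xy$, where $y$ is a vertex in the part of size $\min\{p,q\}$. *)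

theory Defs
  imports "Jordan_Normal_Form.Char_Poly" "HOL-Library.Multiset"
begin

text \<open>A finite simple graph on the vertex set {0..<n}: a pair (n, E) where E is a set
  of 2-element subsets of {0..<n}.\<close>
type_synonym graph = "nat \<times> nat set set"

definition simple_graph :: "graph \<Rightarrow> bool" where
  "simple_graph G \<longleftrightarrow> (\<forall>e\<in>snd G. \<exists>u v. e = {u, v} \<and> u \<noteq> v \<and> u < fst G \<and> v < fst G)"

definition adj_matrix :: "graph \<Rightarrow> complex mat" where
  "adj_matrix G = mat (fst G) (fst G) (\<lambda>(i, j). if {i, j} \<in> snd G then 1 else 0)"

definition spectrum_mset :: "complex mat \<Rightarrow> complex multiset" where
  "spectrum_mset A = (THE M. char_poly A = (\<Prod>a\<in>#M. [:- a, 1:]))"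

definition graph_spectrum :: "graph \<Rightarrow> complex multiset" where
  "graph_spectrum G = spectrum_mset (adj_matrix G)"

definition cospectral :: "graph \<Rightarrow> graph \<Rightarrow> bool" where
  "cospectral G H \<longleftrightarrow> graph_spectrum G = graph_spectrum H"

definition graph_iso :: "graph \<Rightarrow> graph \<Rightarrow> bool" where
  "graph_iso G H \<longleftrightarrow> (\<exists>f. bij_betw f {0..<fst G} {0..<fst H} \<and>
     (\<forall>u<fst G. \<forall>v<fst G. {u, v} \<in> snd G \<longleftrightarrow> {f u, f v} \<in> snd H))"

definition determined_by_spectrum :: "graph \<Rightarrow> bool" where
  "determined_by_spectrum G \<longleftrightarrow>
     (\<forall>H. simple_graph H \<longrightarrow> cospectral H G \<longrightarrow> graph_iso H G)"

text \<open>K_{p,q}^+ for p \<le> q: parts {0..<p} and {p..<p+q}, new vertex p+q joined to 0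
  (a vertex of the part of size p = min p q).\<close>
definition K_plus :: "nat \<Rightarrow> nat \<Rightarrow> graph" where
  "K_plus p q = (p + q + 1,
     {{u, v} | u v. u < p \<and> p \<le> v \<and> v < p + q} \<union> {{p + q, 0}})"

definition K_minus_plus_isolated :: "nat \<Rightarrow> nat \<Rightarrow> nat \<Rightarrow> graph" where
  "K_minus_plus_isolated a b k = (a + b + k,
     {{u, v} | u v. u < a \<and> a \<le> v \<and> v < a + b} - {{0, a}})"

end

theory Submission
  imports Defs "Jordan_Normal_Form.Schur_Decomposition"
begin

text \<open>
  Two graphs are cospectral iff they have the same number of closed walks of every length, so the
  argument can be phrased with walk counts. Both \<open>K\<^sub>p\<^sub>,\<^sub>q\<^sup>+\<close> and \<open>K\<^sub>p\<^sub>,\<^sub>q\<^sup>-\<close> are blow-ups of the path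
  \<open>P\<^sub>4\<close> (plus isolated vertices); if the classes have sizes \<open>a, b, c, d\<close> along the path, the
  adjacency matrix satisfies \<open>A\<^sup>5 = m A\<^sup>3 - e A\<close> with \<open>m = ab + bc + cd\<close> and \<open>e = abcd\<close>, so the spectrum
  is determined by \<open>m\<close>, \<open>e\<close> and the number of vertices.

  Conversely let \<open>G\<close> be cospectral with \<open>K\<^sub>p\<^sub>,\<^sub>q\<^sup>+\<close>. There are no closed walks of odd length, hence \<open>G\<close> is
  bipartite, with a colour class \<open>X\<close>. The numbers of closed walks of lengths 2, 4, 6 show that the
  Gram determinants of triples of neighbourhoods of vertices in \<open>X\<close> sum to 0; being nonnegative
  they all vanish, so any three neighbourhoods are linearly dependent as 0/1 vectors. As
  \<open>e + 1 < m\<close>, two neighbourhoods are never incomparable, and then there are exactly two nonempty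
  ones, one inside the other: \<open>G\<close> is a blow-up of \<open>P\<^sub>4\<close>. The equations \<open>ab + bc + cd = pq + 1\<close> and
  \<open>abcd = q(p - 1)\<close> leave only the sizes of \<open>K\<^sub>p\<^sub>,\<^sub>q\<^sup>+\<close> and sizes with \<open>a = d = 1\<close>, which give
  \<open>K\<^sub>b\<^sub>+\<^sub>1\<^sub>,\<^sub>c\<^sub>+\<^sub>1\<^sup>-\<close>.
\<close>

section \<open>Traces of powers and power sums\<close>

definition mtrace :: "'a::comm_ring_1 mat \<Rightarrow> 'a" where
  "mtrace A = (\<Sum>i<dim_row A. A $$ (i, i))"

lemma mtrace_mult_commute:
  assumes "A \<in> carrier_mat n n" "B \<in> carrier_mat n n"
  shows "mtrace (A * B) = mtrace (B * A)"
proof -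
  have "mtrace (A * B) = (\<Sum>i<n. \<Sum>j<n. A $$ (i, j) * B $$ (j, i))"
    using assms by (auto simp: mtrace_def scalar_prod_def lessThan_atLeast0 intro!: sum.cong)
  also have "\<dots> = (\<Sum>j<n. \<Sum>i<n. B $$ (j, i) * A $$ (i, j))"
    by (subst sum.swap) (simp add: mult.commute)
  also have "\<dots> = mtrace (B * A)"
    using assms by (auto simp: mtrace_def scalar_prod_def lessThan_atLeast0 intro!: sum.cong)
  finally show ?thesis .
qed

lemma mtrace_similar:
  assumes "similar_mat_wit A B P Q" "A \<in> carrier_mat n n"
  shows "mtrace A = mtrace B"
proof -
  have d: "A = P * B * Q" "Q * P = 1\<^sub>m n" "B \<in> carrier_mat n n" "P \<in> carrier_mat n n" "Q \<in> carrier_mat n n"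
    using assms unfolding similar_mat_wit_def Let_def by auto
  have "mtrace A = mtrace (P * (B * Q))"
    using d by (simp add: assoc_mult_mat)
  also have "\<dots> = mtrace ((B * Q) * P)"
    by (rule mtrace_mult_commute) (use d in auto)
  also have "(B * Q) * P = B * (Q * P)"
    using d by (intro assoc_mult_mat) auto
  finally show ?thesis using d by simp
qed

lemma upper_triangular_pow:
  fixes B :: "'a::comm_ring_1 mat"
  assumes B: "B \<in> carrier_mat n n" "upper_triangular B"
  shows "upper_triangular (B ^\<^sub>m k) \<and> (\<forall>i<n. (B ^\<^sub>m k) $$ (i, i) = (B $$ (i, i)) ^ k)"
proof (induction k)
  case 0
  show ?case using B by auto
next
  case (Suc k)
  let ?C = "B ^\<^sub>m k"
  have C: "?C \<in> carrier_mat n n" using B by simp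
  have entry: "(?C * B) $$ (i, j) = (\<Sum>l<n. ?C $$ (i, l) * B $$ (l, j))" if "i < n" "j < n" for i j
    using that C B by (auto simp: scalar_prod_def lessThan_atLeast0)
  have z: "?C $$ (i, l) * B $$ (l, j) = 0" if "j < i \<or> (i = j \<and> l \<noteq> i)" "i < n" "j < n" "l < n" for i j l
  proof (cases "l < i")
    case True
    then have "?C $$ (i, l) = 0" using Suc C that by auto
    then show ?thesis by simp
  next
    case False
    then have "j < l" using that by auto
    then have "B $$ (l, j) = 0" using B that by auto
    then show ?thesis by simp
  qed
  show ?case
  proof (intro conjI allI impI)
    show "upper_triangular (B ^\<^sub>m Suc k)"
    proof (rule upper_triangularI)
      fix i j assume "j < i" "i < dim_row (B ^\<^sub>m Suc k)"
      then have "j < i" "i < n" using B by auto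
      then show "(B ^\<^sub>m Suc k) $$ (i, j) = 0"
        using entry[of i j] z[of j i] by simp
    qed
  next
    fix i assume i: "i < n"
    have "(?C * B) $$ (i, i) = (\<Sum>l<n. if l = i then ?C $$ (i, i) * B $$ (i, i) else 0)"
      unfolding entry[OF i i] using z[of i i] i by (intro sum.cong) auto
    also have "\<dots> = ?C $$ (i, i) * B $$ (i, i)" using i by simp
    finally show "(B ^\<^sub>m Suc k) $$ (i, i) = B $$ (i, i) ^ Suc k"
      using Suc i by simp
  qed
qed

text \<open>Schur triangularisation puts the eigenvalues on the diagonal. Similarity preserves
  traces, and powers of a triangular matrix have the powers of its diagonal on their
  diagonal.\<close>

lemma mtrace_pow_eq_sum:
  fixes A :: "complex mat"
  assumes A: "A \<in> carrier_mat n n" and c: "char_poly A = (\<Prod>a\<in>#M. [:- a, 1:])"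
  shows "mtrace (A ^\<^sub>m k) = (\<Sum>a\<in>#M. a ^ k)"
proof -
  obtain es where es: "mset es = M" using ex_mset by blast
  have c': "char_poly A = (\<Prod>a\<leftarrow>es. [:- a, 1:])"
    unfolding c es[symmetric] by (metis mset_map prod_mset_prod_list)
  obtain B P Q where sd: "schur_decomposition A es = (B, P, Q)"
    by (cases "schur_decomposition A es") auto
  from schur_decomposition[OF A c' sd]
  have w: "similar_mat_wit A B P Q" and ut: "upper_triangular B" and dg: "diag_mat B = es"
    by auto
  have B: "B \<in> carrier_mat n n"
    using w A unfolding similar_mat_wit_def Let_def by auto
  have "mtrace (A ^\<^sub>m k) = mtrace (B ^\<^sub>m k)"
    by (rule mtrace_similar[OF similar_mat_wit_pow[OF w]]) (use A in auto)
  also have "\<dots> = (\<Sum>i<n. (B $$ (i, i)) ^ k)"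
    using upper_triangular_pow[OF B ut, of k] B by (auto simp: mtrace_def)
  also have "\<dots> = (\<Sum>a\<leftarrow>diag_mat B. a ^ k)"
    using B by (simp add: diag_mat_def sum_list_sum_nth lessThan_atLeast0)
  also have "\<dots> = (\<Sum>a\<in>#M. a ^ k)"
    unfolding dg es[symmetric] by (metis mset_map sum_mset_sum_list)
  finally show ?thesis .
qed

text \<open>Justifies the definite description in \<open>spectrum_mset\<close>: a factorisation
  exists over the complex numbers, and \<open>proots\<close> recovers the multiset from the
  product.\<close>

lemma char_poly_eq_spectrum:
  assumes "A \<in> carrier_mat n n"
  shows "char_poly A = (\<Prod>a\<in>#spectrum_mset A. [:- a, 1:])"
proof -
  have uniq: "proots (\<Prod>a\<in>#M. [:- a, 1:]) = M" for M :: "complex multiset"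
  proof (induction M)
    case (add x M)
    have "(\<Prod>a\<in>#M. [:- a, 1:]) \<noteq> 0" by (auto simp: prod_mset_zero_iff)
    then have "proots ([:- x, 1:] * (\<Prod>a\<in>#M. [:- a, 1:])) = {#x#} + M"
      using add by (subst proots_mult) auto
    then show ?case by simp
  qed simp
  obtain as where as: "char_poly A = (\<Prod>a\<leftarrow>as. [:- a, 1:])"
    using char_poly_factorized[OF assms] by blast
  have ex: "char_poly A = (\<Prod>a\<in>#mset as. [:- a, 1:])"
    unfolding as by (metis mset_map prod_mset_prod_list)
  show ?thesis unfolding spectrum_mset_def
  proof (rule theI[where a = "mset as"])
    show "char_poly A = (\<Prod>a\<in>#mset as. [:- a, 1:])" by (rule ex)
    show "M = mset as" if "char_poly A = (\<Prod>a\<in>#M. [:- a, 1:])" for M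
      using that ex uniq by metis
  qed
qed

lemma multiset_eq_if_power_sums_eq:
  fixes M N :: "'a::{idom, ring_char_0} multiset"
  assumes "\<And>k. (\<Sum>a\<in>#M. a ^ k) = (\<Sum>a\<in>#N. a ^ k)"
  shows "M = N"
proof (rule multiset_eqI)
  fix x
  have pol: "(\<Sum>a\<in>#L. poly f a) = (\<Sum>i\<le>degree f. coeff f i * (\<Sum>a\<in>#L. a ^ i))"
    for f :: "'a poly" and L
    by (induction L) (simp_all add: poly_altdef sum.distrib distrib_left)
  have eq: "(\<Sum>a\<in>#M. poly f a) = (\<Sum>a\<in>#N. poly f a)" for f
    unfolding pol using assms by simp
  \<comment> \<open>Equal power sums mean equal sums of all polynomials; \<open>f\<close> isolates the multiplicity of \<open>x\<close>.\<close>
  define U where "U = set_mset M \<union> set_mset N - {x}"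
  define f where "f = (\<Prod>b\<in>U. [:- b, 1:])"
  have U: "finite U" "x \<notin> U" by (auto simp: U_def)
  have fx: "poly f x \<noteq> 0" using U by (auto simp: f_def poly_prod)
  have f0: "poly f a = 0" if "a \<in> U" for a
    using that U by (auto simp: f_def poly_prod)
  have count: "(\<Sum>a\<in>#L. poly f a) = of_nat (count L x) * poly f x"
    if "set_mset L \<subseteq> insert x U" for L
    using that by (induction L) (auto simp: f0 distrib_right)
  have "of_nat (count M x) * poly f x = of_nat (count N x) * poly f x"
    using eq[of f] count[of M] count[of N] unfolding U_def by force
  then show "count M x = count N x" using fx by simp
qed

section \<open>Closed walks\<close>

text \<open>Real-valued because the recurrences and determinants below involve subtraction.\<close>

fun walks :: "graph \<Rightarrow> nat \<Rightarrow> nat \<Rightarrow> nat \<Rightarrow> real" where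
  "walks G 0 u v = of_bool (u = v)"
| "walks G (Suc k) u v = (\<Sum>z<fst G. of_bool ({u, z} \<in> snd G) * walks G k z v)"

definition closed_walks :: "graph \<Rightarrow> nat \<Rightarrow> real" where
  "closed_walks G k = (\<Sum>v<fst G. walks G k v v)"

lemma walks_add:
  assumes "u < fst G"
  shows "walks G (j + k) u v = (\<Sum>z<fst G. walks G j u z * walks G k z v)"
  using assms
proof (induction j arbitrary: u)
  case 0
  then show ?case by simp
next
  case (Suc j)
  have "walks G (Suc j + k) u v = (\<Sum>y<fst G. \<Sum>z<fst G.
      of_bool ({u, y} \<in> snd G) * (walks G j y z * walks G k z v))"
    using Suc.IH by (simp add: sum_distrib_left)
  also have "\<dots> = (\<Sum>z<fst G. \<Sum>y<fst G.
      of_bool ({u, y} \<in> snd G) * (walks G j y z * walks G k z v))"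
    by (rule sum.swap)
  finally show ?case by (simp add: sum_distrib_right mult.assoc)
qed

lemma walks_1:
  assumes "v < fst G"
  shows "walks G 1 u v = of_bool ({u, v} \<in> snd G)"
proof -
  have "walks G 1 u v = (\<Sum>z<fst G. if z = v then of_bool ({u, v} \<in> snd G) else 0)"
    unfolding One_nat_def walks.simps by (intro sum.cong) auto
  then show ?thesis using assms by simp
qed

lemma adj_matrix_pow:
  assumes "u < fst G" "v < fst G"
  shows "(adj_matrix G ^\<^sub>m k) $$ (u, v) = of_real (walks G k u v)"
  using assms
proof (induction k arbitrary: v)
  case 0
  then show ?case by (simp add: adj_matrix_def)
next
  case (Suc k)
  have A: "adj_matrix G \<in> carrier_mat (fst G) (fst G)" by (simp add: adj_matrix_def)
  then have Ak: "adj_matrix G ^\<^sub>m k \<in> carrier_mat (fst G) (fst G)" by simp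
  \<comment> \<open>\<open>walks\<close> splits off the first step, the matrix power the last one; a
    final segment of length 1 in \<open>walks_add\<close> reconciles the two.\<close>
  have *: "walks G (Suc k) u v = (\<Sum>z<fst G. walks G k u z * of_bool ({z, v} \<in> snd G))"
    using walks_add[OF Suc.prems(1), of k 1 v] walks_1[OF Suc.prems(2)] by simp
  have "(adj_matrix G ^\<^sub>m Suc k) $$ (u, v)
      = (\<Sum>z<fst G. (adj_matrix G ^\<^sub>m k) $$ (u, z) * adj_matrix G $$ (z, v))"
    using A Ak Suc.prems by (auto simp: scalar_prod_def lessThan_atLeast0)
  also have "\<dots> = (\<Sum>z<fst G. of_real (walks G k u z) * of_bool ({z, v} \<in> snd G))"
    by (rule sum.cong) (use Suc in \<open>auto simp: adj_matrix_def\<close>)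
  finally show ?case unfolding * by (simp add: of_bool_def if_distrib cong: if_cong)
qed

text \<open>The trace of the \<open>k\<close>-th power of the adjacency matrix is both a walk count
  and a power sum of eigenvalues, and all power sums together determine a multiset.\<close>

lemma cospectral_iff_closed_walks:
  "cospectral G H \<longleftrightarrow> closed_walks G = closed_walks H"
proof -
  have key: "of_real (closed_walks K k) = (\<Sum>a\<in>#graph_spectrum K. a ^ k)" for K k
  proof -
    have A: "adj_matrix K \<in> carrier_mat (fst K) (fst K)" by (simp add: adj_matrix_def)
    have "mtrace (adj_matrix K ^\<^sub>m k) = of_real (closed_walks K k)"
      using A by (simp add: mtrace_def closed_walks_def adj_matrix_pow)
    then show ?thesis
      using mtrace_pow_eq_sum[OF A char_poly_eq_spectrum[OF A]] by (simp add: graph_spectrum_def)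
  qed
  show ?thesis unfolding cospectral_def
  proof
    assume "graph_spectrum G = graph_spectrum H"
    then have "complex_of_real (closed_walks G k) = of_real (closed_walks H k)" for k
      unfolding key by simp
    then show "closed_walks G = closed_walks H" by (auto simp: fun_eq_iff)
  next
    assume "closed_walks G = closed_walks H"
    then show "graph_spectrum G = graph_spectrum H"
      using key by (intro multiset_eq_if_power_sums_eq) metis
  qed
qed

section \<open>Blow-ups of the path on four vertices\<close>

text \<open>The classes need not cover the vertex set; the remaining vertices are isolated. Empty
  classes are allowed.\<close>

definition P4_blowup :: "graph \<Rightarrow> nat set \<Rightarrow> nat set \<Rightarrow> nat set \<Rightarrow> nat set \<Rightarrow> bool" where
  "P4_blowup G A B C D \<longleftrightarrow>
     A \<subseteq> {..<fst G} \<and> B \<subseteq> {..<fst G} \<and> C \<subseteq> {..<fst G} \<and> D \<subseteq> {..<fst G} \<and>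
     A \<inter> B = {} \<and> A \<inter> C = {} \<and> A \<inter> D = {} \<and> B \<inter> C = {} \<and> B \<inter> D = {} \<and> C \<inter> D = {} \<and>
     (\<forall>u v. {u, v} \<in> snd G \<longleftrightarrow>
        u \<in> A \<and> v \<in> B \<or> u \<in> B \<and> v \<in> A \<or> u \<in> B \<and> v \<in> C \<or> u \<in> C \<and> v \<in> B \<or>
        u \<in> C \<and> v \<in> D \<or> u \<in> D \<and> v \<in> C)"

lemma P4_blowup_subset:
  assumes "P4_blowup G A B C D"
  shows "A \<subseteq> {..<fst G}" "B \<subseteq> {..<fst G}" "C \<subseteq> {..<fst G}" "D \<subseteq> {..<fst G}"
  using assms by (simp_all add: P4_blowup_def)

lemma P4_blowup_disjoint:
  assumes "P4_blowup G A B C D"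
  shows "u \<in> A \<Longrightarrow> u \<notin> B \<and> u \<notin> C \<and> u \<notin> D" "u \<in> B \<Longrightarrow> u \<notin> A \<and> u \<notin> C \<and> u \<notin> D"
    "u \<in> C \<Longrightarrow> u \<notin> A \<and> u \<notin> B \<and> u \<notin> D" "u \<in> D \<Longrightarrow> u \<notin> A \<and> u \<notin> B \<and> u \<notin> C"
proof -
  have "A \<inter> B = {}" "A \<inter> C = {}" "A \<inter> D = {}" "B \<inter> C = {}" "B \<inter> D = {}" "C \<inter> D = {}"
    using assms by (simp_all add: P4_blowup_def)
  then show "u \<in> A \<Longrightarrow> u \<notin> B \<and> u \<notin> C \<and> u \<notin> D" "u \<in> B \<Longrightarrow> u \<notin> A \<and> u \<notin> C \<and> u \<notin> D"
     "u \<in> C \<Longrightarrow> u \<notin> A \<and> u \<notin> B \<and> u \<notin> D" "u \<in> D \<Longrightarrow> u \<notin> A \<and> u \<notin> B \<and> u \<notin> C"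
    by blast+
qed

lemma P4_blowup_edge_iff:
  assumes "P4_blowup G A B C D"
  shows "{u, v} \<in> snd G \<longleftrightarrow>
    u \<in> A \<and> v \<in> B \<or> u \<in> B \<and> v \<in> A \<or> u \<in> B \<and> v \<in> C \<or> u \<in> C \<and> v \<in> B \<or>
    u \<in> C \<and> v \<in> D \<or> u \<in> D \<and> v \<in> C"
  using assms by (simp add: P4_blowup_def)

lemma P4_blowup_sym:
  assumes "P4_blowup G A B C D"
  shows "P4_blowup G D C B A"
  unfolding P4_blowup_def P4_blowup_edge_iff[OF assms]
proof (intro conjI allI)
  show "D \<inter> C = {}" "D \<inter> B = {}" "D \<inter> A = {}" "C \<inter> B = {}" "C \<inter> A = {}" "B \<inter> A = {}"
    using P4_blowup_disjoint[OF assms] by blast+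
qed (use P4_blowup_subset[OF assms] in argo)+

lemma P4_blowup_finite:
  assumes "P4_blowup G A B C D"
  shows "finite A" "finite B" "finite C" "finite D"
  using P4_blowup_subset[OF assms] by (auto intro: finite_subset[OF _ finite_lessThan])

lemma P4_blowup_neighbour_sum:
  assumes bl: "P4_blowup G A B C D"
  shows "(\<Sum>z<fst G. of_bool ({u, z} \<in> snd G) * f z) =
     of_bool (u \<in> A) * sum f B + of_bool (u \<in> B) * (sum f A + sum f C)
     + of_bool (u \<in> C) * (sum f B + sum f D) + of_bool (u \<in> D) * (sum f C :: real)"
proof -
  note sub = P4_blowup_subset[OF bl]
  have ext: "sum f S = (\<Sum>z<fst G. of_bool (z \<in> S) * f z)" if "S \<subseteq> {..<fst G}" for S
    using that by (intro sum.mono_neutral_cong_left) auto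
  have "(\<Sum>z<fst G. of_bool ({u, z} \<in> snd G) * f z) = (\<Sum>z<fst G.
      of_bool (u \<in> A) * (of_bool (z \<in> B) * f z)
      + of_bool (u \<in> B) * (of_bool (z \<in> A) * f z + of_bool (z \<in> C) * f z)
      + of_bool (u \<in> C) * (of_bool (z \<in> B) * f z + of_bool (z \<in> D) * f z)
      + of_bool (u \<in> D) * (of_bool (z \<in> C) * f z))"
  proof (rule sum.cong[OF refl])
    fix z
    note E = P4_blowup_edge_iff[OF bl, of u z]
    have dis: "u \<in> A \<Longrightarrow> u \<notin> B \<and> u \<notin> C \<and> u \<notin> D" "u \<in> B \<Longrightarrow> u \<notin> C \<and> u \<notin> D" "u \<in> C \<Longrightarrow> u \<notin> D"
      "z \<in> A \<Longrightarrow> z \<notin> C" "z \<in> B \<Longrightarrow> z \<notin> D"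
      using P4_blowup_disjoint[OF bl] by blast+
    show "of_bool ({u, z} \<in> snd G) * f z =
      of_bool (u \<in> A) * (of_bool (z \<in> B) * f z)
      + of_bool (u \<in> B) * (of_bool (z \<in> A) * f z + of_bool (z \<in> C) * f z)
      + of_bool (u \<in> C) * (of_bool (z \<in> B) * f z + of_bool (z \<in> D) * f z)
      + of_bool (u \<in> D) * (of_bool (z \<in> C) * f z)"
      unfolding E using dis by (auto simp: of_bool_def)
  qed
  then show ?thesis
    unfolding ext[OF sub(1)] ext[OF sub(2)] ext[OF sub(3)] ext[OF sub(4)]
    by (simp only: sum.distrib sum_distrib_left distrib_left)
qed

lemma P4_blowup_walks_Suc:
  assumes "P4_blowup G A B C D"
  shows "walks G (Suc k) u v =
     of_bool (u \<in> A) * (\<Sum>z\<in>B. walks G k z v)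
     + of_bool (u \<in> B) * ((\<Sum>z\<in>A. walks G k z v) + (\<Sum>z\<in>C. walks G k z v))
     + of_bool (u \<in> C) * ((\<Sum>z\<in>B. walks G k z v) + (\<Sum>z\<in>D. walks G k z v))
     + of_bool (u \<in> D) * (\<Sum>z\<in>C. walks G k z v)"
  unfolding walks.simps by (rule P4_blowup_neighbour_sum[OF assms])

text \<open>The four classes form an equitable partition, so the sums of walk counts over classes
  satisfy a closed linear system, governed by the 4 by 4 quotient matrix.\<close>

lemma P4_blowup_class_sums:
  assumes bl: "P4_blowup G A B C D"
  shows "(\<Sum>z\<in>A. walks G (Suc k) z v) = card A * (\<Sum>z\<in>B. walks G k z v)"
    and "(\<Sum>z\<in>B. walks G (Suc k) z v) = card B * ((\<Sum>z\<in>A. walks G k z v) + (\<Sum>z\<in>C. walks G k z v))"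
    and "(\<Sum>z\<in>C. walks G (Suc k) z v) = card C * ((\<Sum>z\<in>B. walks G k z v) + (\<Sum>z\<in>D. walks G k z v))"
    and "(\<Sum>z\<in>D. walks G (Suc k) z v) = card D * (\<Sum>z\<in>C. walks G k z v)"
proof -
  note dis = P4_blowup_disjoint[OF bl]
  note W = P4_blowup_walks_Suc[OF bl]
  have "(\<Sum>z\<in>A. walks G (Suc k) z v) = (\<Sum>z\<in>A. \<Sum>z\<in>B. walks G k z v)"
    by (rule sum.cong) (simp_all add: W dis(1) del: walks.simps)
  then show "(\<Sum>z\<in>A. walks G (Suc k) z v) = card A * (\<Sum>z\<in>B. walks G k z v)" by simp
  have "(\<Sum>z\<in>B. walks G (Suc k) z v) = (\<Sum>z\<in>B. (\<Sum>z\<in>A. walks G k z v) + (\<Sum>z\<in>C. walks G k z v))"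
    by (rule sum.cong) (simp_all add: W dis(2) del: walks.simps)
  then show "(\<Sum>z\<in>B. walks G (Suc k) z v) = card B * ((\<Sum>z\<in>A. walks G k z v) + (\<Sum>z\<in>C. walks G k z v))" by simp
  have "(\<Sum>z\<in>C. walks G (Suc k) z v) = (\<Sum>z\<in>C. (\<Sum>z\<in>B. walks G k z v) + (\<Sum>z\<in>D. walks G k z v))"
    by (rule sum.cong) (simp_all add: W dis(3) del: walks.simps)
  then show "(\<Sum>z\<in>C. walks G (Suc k) z v) = card C * ((\<Sum>z\<in>B. walks G k z v) + (\<Sum>z\<in>D. walks G k z v))" by simp
  have "(\<Sum>z\<in>D. walks G (Suc k) z v) = (\<Sum>z\<in>D. \<Sum>z\<in>C. walks G k z v)"
    by (rule sum.cong) (simp_all add: W dis(4) del: walks.simps)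
  then show "(\<Sum>z\<in>D. walks G (Suc k) z v) = card D * (\<Sum>z\<in>C. walks G k z v)" by simp
qed

definition P4_edges :: "nat \<Rightarrow> nat \<Rightarrow> nat \<Rightarrow> nat \<Rightarrow> nat" where
  "P4_edges a b c d = a * b + b * c + c * d"

text \<open>The quotient matrix has characteristic polynomial \<open>x^4 - m x^2 + e\<close>, so the
  class sums obey the corresponding recurrence. One more step leads from class sums to walks; the
  shift to lengths at least 1 is due to the eigenvalue 0 outside the quotient.\<close>

lemma P4_blowup_walks_rec:
  assumes bl: "P4_blowup G A B C D"
  defines "m \<equiv> real (P4_edges (card A) (card B) (card C) (card D))"
    and "e \<equiv> real (card A * card B * card C * card D)"
  shows "walks G (k + 5) u v = m * walks G (k + 3) u v - e * walks G (k + 1) u v"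
proof -
  note S = P4_blowup_class_sums[OF bl]
  note md = m_def e_def P4_edges_def
  define sA where "sA k = (\<Sum>z\<in>A. walks G k z v)" for k
  define sB where "sB k = (\<Sum>z\<in>B. walks G k z v)" for k
  define sC where "sC k = (\<Sum>z\<in>C. walks G k z v)" for k
  define sD where "sD k = (\<Sum>z\<in>D. walks G k z v)" for k
  have s: "sA (Suc k) = card A * sB k" "sB (Suc k) = card B * (sA k + sC k)"
    "sC (Suc k) = card C * (sB k + sD k)" "sD (Suc k) = card D * sC k" for k
    unfolding sA_def sB_def sC_def sD_def by (rule S)+
  have four: "k + 4 = Suc (Suc (Suc (Suc k)))" "k + 2 = Suc (Suc k)" by simp_all
  have rA: "sA (k + 4) = m * sA (k + 2) - e * sA k"
    unfolding four s md by (simp add: algebra_simps)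
  have rB: "sB (k + 4) = m * sB (k + 2) - e * sB k"
    unfolding four s md by (simp add: algebra_simps)
  have rC: "sC (k + 4) = m * sC (k + 2) - e * sC k"
    unfolding four s md by (simp add: algebra_simps)
  have rD: "sD (k + 4) = m * sD (k + 2) - e * sD k"
    unfolding four s md by (simp add: algebra_simps)
  have W: "walks G (Suc j) u v = of_bool (u \<in> A) * sB j + of_bool (u \<in> B) * (sA j + sC j)
     + of_bool (u \<in> C) * (sB j + sD j) + of_bool (u \<in> D) * sC j" for j
    unfolding sA_def sB_def sC_def sD_def by (rule P4_blowup_walks_Suc[OF bl])
  have five: "k + 5 = Suc (k + 4)" "k + 3 = Suc (k + 2)" "k + 1 = Suc k" by simp_all
  show ?thesis unfolding five W rA rB rC rD by (simp add: algebra_simps)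
qed

lemma P4_blowup_closed_walks_rec:
  assumes bl: "P4_blowup G A B C D"
  shows "closed_walks G (k + 5) =
    real (P4_edges (card A) (card B) (card C) (card D)) * closed_walks G (k + 3)
    - real (card A * card B * card C * card D) * closed_walks G (k + 1)"
  unfolding closed_walks_def P4_blowup_walks_rec[OF bl] sum_subtractf sum_distrib_left ..

text \<open>Initial values for the recurrence. They agree with the eigenvalues being 0 and the plus
  and minus square roots of the zeros of \<open>t^2 - m t + e\<close>.\<close>

lemma P4_blowup_closed_walks_small:
  assumes bl: "P4_blowup G A B C D"
  defines "m \<equiv> real (P4_edges (card A) (card B) (card C) (card D))"
    and "e \<equiv> real (card A * card B * card C * card D)"
  shows "closed_walks G 0 = fst G" "closed_walks G 1 = 0" "closed_walks G 2 = 2 * m"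
    "closed_walks G 3 = 0" "closed_walks G 4 = 2 * (m\<^sup>2 - 2 * e)"
proof -
  note S = P4_blowup_class_sums[OF bl]
  note fin = P4_blowup_finite[OF bl]
  have ext: "(\<Sum>z<fst G. of_bool (z \<in> X) * f z) = sum f X" if "X \<subseteq> {..<fst G}" for X and f :: "nat \<Rightarrow> real"
    using that by (intro sum.mono_neutral_cong_right) auto
  note dis = P4_blowup_disjoint[OF bl]
  note sub = P4_blowup_subset[OF bl]
  define s where "s X k v = (\<Sum>z\<in>X. walks G k z v)" for X k v
  have cw: "closed_walks G (Suc k) = (\<Sum>v\<in>A. s B k v) + (\<Sum>v\<in>B. s A k v + s C k v)
     + (\<Sum>v\<in>C. s B k v + s D k v) + (\<Sum>v\<in>D. s C k v)" for k
    unfolding closed_walks_def P4_blowup_walks_Suc[OF bl] s_def[symmetric]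
    by (simp only: sum.distrib ext[OF sub(1)] ext[OF sub(2)] ext[OF sub(3)] ext[OF sub(4)])
  have s0: "s X 0 v = of_bool (v \<in> X)" if "finite X" for X v
    using that by (simp add: s_def of_bool_def)
  have sS: "s A (Suc k) v = card A * s B k v" "s B (Suc k) v = card B * (s A k v + s C k v)"
    "s C (Suc k) v = card C * (s B k v + s D k v)" "s D (Suc k) v = card D * s C k v" for k v
    unfolding s_def by (rule S)+
  have num: "(2::nat) = Suc (Suc 0)" "(3::nat) = Suc (Suc (Suc 0))" "(4::nat) = Suc (Suc (Suc (Suc 0)))" "(1::nat) = Suc 0"
    by simp_all
  note s0s = s0[OF fin(1)] s0[OF fin(2)] s0[OF fin(3)] s0[OF fin(4)]
  have initA: "v \<in> A \<Longrightarrow> s A 0 v = 1 \<and> s B 0 v = 0 \<and> s C 0 v = 0 \<and> s D 0 v = 0" for v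
    unfolding s0s using dis(1)[of v] by simp
  have initB: "v \<in> B \<Longrightarrow> s A 0 v = 0 \<and> s B 0 v = 1 \<and> s C 0 v = 0 \<and> s D 0 v = 0" for v
    unfolding s0s using dis(2)[of v] by simp
  have initC: "v \<in> C \<Longrightarrow> s A 0 v = 0 \<and> s B 0 v = 0 \<and> s C 0 v = 1 \<and> s D 0 v = 0" for v
    unfolding s0s using dis(3)[of v] by simp
  have initD: "v \<in> D \<Longrightarrow> s A 0 v = 0 \<and> s B 0 v = 0 \<and> s C 0 v = 0 \<and> s D 0 v = 1" for v
    unfolding s0s using dis(4)[of v] by simp
  note init = initA initB initC initD
  show "closed_walks G 0 = fst G" by (simp add: closed_walks_def)
  show "closed_walks G 1 = 0" unfolding num cw by (simp add: init sS cong: sum.cong)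
  show "closed_walks G 2 = 2 * m"
    unfolding num cw by (simp add: init sS m_def P4_edges_def algebra_simps cong: sum.cong)
  show "closed_walks G 3 = 0" unfolding num cw by (simp add: init sS cong: sum.cong)
  have "closed_walks G (Suc (Suc (Suc (Suc 0)))) = 2 * (m\<^sup>2 - 2 * e)"
    unfolding cw by (simp add: init sS m_def e_def P4_edges_def algebra_simps power2_eq_square cong: sum.cong)
  then show "closed_walks G 4 = 2 * (m\<^sup>2 - 2 * e)" by (simp add: num(3))
qed

text \<open>The recurrence and the five initial values involve only the number of vertices,
  \<open>m\<close> and \<open>e\<close>.\<close>

lemma P4_blowup_closed_walks_eq:
  assumes G: "P4_blowup G A B C D" and H: "P4_blowup H A' B' C' D'"
    and n: "fst G = fst H"
    and m: "P4_edges (card A) (card B) (card C) (card D) = P4_edges (card A') (card B') (card C') (card D')"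
    and e: "card A * card B * card C * card D = card A' * card B' * card C' * card D'"
  shows "closed_walks G k = closed_walks H k"
proof (induction k rule: less_induct)
  case (less k)
  show ?case
  proof (cases "k < 5")
    case True
    then have "k = 0 \<or> k = 1 \<or> k = 2 \<or> k = 3 \<or> k = 4" by auto
    then show ?thesis
      using P4_blowup_closed_walks_small[OF G] P4_blowup_closed_walks_small[OF H] n m e by auto
  next
    case False
    then obtain j where j: "k = j + 5" using le_iff_add[of 5 k] by (auto simp: not_less)
    have "closed_walks G (j + 3) = closed_walks H (j + 3)" "closed_walks G (j + 1) = closed_walks H (j + 1)"
      using less j by simp_all
    then show ?thesis
      unfolding j P4_blowup_closed_walks_rec[OF G] P4_blowup_closed_walks_rec[OF H] m e by simp
  qed
qed

lemma P4_blowup_iso: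
  assumes G: "P4_blowup G A B C D" and H: "P4_blowup H A' B' C' D'"
    and n: "fst G = fst H"
    and c: "card A = card A'" "card B = card B'" "card C = card C'" "card D = card D'"
  shows "graph_iso G H"
proof -
  define R where "R = {..<fst G} - (A \<union> B \<union> C \<union> D)"
  define R' where "R' = {..<fst H} - (A' \<union> B' \<union> C' \<union> D')"
  note fin = P4_blowup_finite[OF G] P4_blowup_finite[OF H]
  have dis: "A \<inter> B = {}" "(A \<union> B) \<inter> C = {}" "(A \<union> B \<union> C) \<inter> D = {}"
    using G by (simp_all add: P4_blowup_def Int_Un_distrib2)
  have disR: "(A \<union> B \<union> C \<union> D) \<inter> R = {}"
    and un: "A \<union> B \<union> C \<union> D \<union> R = {0..<fst G}"
    using P4_blowup_subset[OF G] unfolding R_def by auto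
  have dis': "A' \<inter> B' = {}" "(A' \<union> B') \<inter> C' = {}" "(A' \<union> B' \<union> C') \<inter> D' = {}"
    using H by (simp_all add: P4_blowup_def Int_Un_distrib2)
  have disR': "(A' \<union> B' \<union> C' \<union> D') \<inter> R' = {}"
    and un': "A' \<union> B' \<union> C' \<union> D' \<union> R' = {0..<fst H}"
    using P4_blowup_subset[OF H] unfolding R'_def by auto
  have "card (A \<union> B \<union> C \<union> D) = card (A' \<union> B' \<union> C' \<union> D')"
    using dis dis' fin c by (simp add: card_Un_disjoint)
  moreover have "A \<union> B \<union> C \<union> D \<subseteq> {..<fst G}" "A' \<union> B' \<union> C' \<union> D' \<subseteq> {..<fst H}"
    using P4_blowup_subset[OF G] P4_blowup_subset[OF H] by auto
  \<comment> \<open>Equal vertex numbers force equally many isolated vertices outside the classes,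
    which supplies the fifth bijection.\<close>
  ultimately have cR: "card R = card R'"
    unfolding R_def R'_def using n fin by (simp add: card_Diff_subset)
  obtain f where f: "bij_betw f A A'" using finite_same_card_bij[OF fin(1) fin(5) c(1)] by blast
  obtain g where g: "bij_betw g B B'" using finite_same_card_bij[OF fin(2) fin(6) c(2)] by blast
  obtain h where h: "bij_betw h C C'" using finite_same_card_bij[OF fin(3) fin(7) c(3)] by blast
  obtain i where i: "bij_betw i D D'" using finite_same_card_bij[OF fin(4) fin(8) c(4)] by blast
  obtain j where j: "bij_betw j R R'" using finite_same_card_bij[of R R'] cR by (auto simp: R_def R'_def)
  define F where "F x = (if x \<in> A \<union> B \<union> C \<union> D then if x \<in> A \<union> B \<union> C then if x \<in> A \<union> B then
     if x \<in> A then f x else g x else h x else i x else j x)" for x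
  have bF: "bij_betw F {0..<fst G} {0..<fst H}"
    unfolding F_def un[symmetric] un'[symmetric]
    using bij_betw_disjoint_Un[OF bij_betw_disjoint_Un[OF bij_betw_disjoint_Un[OF
      bij_betw_disjoint_Un[OF f g dis(1) dis'(1)] h dis(2) dis'(2)] i dis(3) dis'(3)] j disR disR'] .
  have mem: "F u \<in> A' \<longleftrightarrow> u \<in> A" "F u \<in> B' \<longleftrightarrow> u \<in> B" "F u \<in> C' \<longleftrightarrow> u \<in> C" "F u \<in> D' \<longleftrightarrow> u \<in> D"
    if "u < fst G" for u
  proof -
    have u: "u \<in> A \<or> u \<in> B \<or> u \<in> C \<or> u \<in> D \<or> u \<in> R" using that by (auto simp: R_def)
    have dR: "u \<in> R \<Longrightarrow> u \<notin> A \<and> u \<notin> B \<and> u \<notin> C \<and> u \<notin> D"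
      "F u \<in> R' \<Longrightarrow> F u \<notin> A' \<and> F u \<notin> B' \<and> F u \<notin> C' \<and> F u \<notin> D'"
      by (auto simp: R_def R'_def)
    have mF: "u \<in> A \<Longrightarrow> F u \<in> A'" "u \<in> B \<Longrightarrow> F u \<in> B'" "u \<in> C \<Longrightarrow> F u \<in> C'" "u \<in> D \<Longrightarrow> F u \<in> D'" "u \<in> R \<Longrightarrow> F u \<in> R'"
      using dis disR bij_betwE[OF f] bij_betwE[OF g] bij_betwE[OF h] bij_betwE[OF i] bij_betwE[OF j]
      unfolding F_def by auto
    show "F u \<in> A' \<longleftrightarrow> u \<in> A" "F u \<in> B' \<longleftrightarrow> u \<in> B" "F u \<in> C' \<longleftrightarrow> u \<in> C" "F u \<in> D' \<longleftrightarrow> u \<in> D"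
      using u mF dR P4_blowup_disjoint[OF G, of u] P4_blowup_disjoint[OF H, of "F u"] by argo+
  qed
  show ?thesis
    unfolding graph_iso_def
  proof (intro exI[of _ F] conjI allI impI bF)
    fix u v assume uv: "u < fst G" "v < fst G"
    show "{u, v} \<in> snd G \<longleftrightarrow> {F u, F v} \<in> snd H"
      unfolding P4_blowup_edge_iff[OF G] P4_blowup_edge_iff[OF H] mem[OF uv(1)] mem[OF uv(2)] ..
  qed
qed

section \<open>The two graph families as blow-ups\<close>

text \<open>Along the path: the part of size \<open>p\<close> without vertex 0, the part of size
  \<open>q\<close>, vertex 0, and its pendant neighbour. The sizes are
  \<open>p - 1, q, 1, 1\<close>.\<close>

lemma K_plus_P4_blowup:
  assumes "1 \<le> p"
  shows "P4_blowup (K_plus p q) {1..<p} {p..<p + q} {0} {p + q}"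
proof -
  have E: "{u, v} \<in> snd (K_plus p q) \<longleftrightarrow>
      u < p \<and> v \<in> {p..<p + q} \<or> u \<in> {p..<p + q} \<and> v < p \<or>
      u \<in> {0} \<and> v \<in> {p + q} \<or> u \<in> {p + q} \<and> v \<in> {0}" for u v
    unfolding K_plus_def by (auto simp: doubleton_eq_iff)
  have lt: "u < p \<longleftrightarrow> u \<in> {1..<p} \<or> u \<in> {0}" for u
    using assms by auto
  show ?thesis
    unfolding P4_blowup_def
  proof (intro conjI allI)
    fix u v
    show "{u, v} \<in> snd (K_plus p q) \<longleftrightarrow>
        u \<in> {1..<p} \<and> v \<in> {p..<p + q} \<or> u \<in> {p..<p + q} \<and> v \<in> {1..<p} \<or>
        u \<in> {p..<p + q} \<and> v \<in> {0} \<or> u \<in> {0} \<and> v \<in> {p..<p + q} \<or>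
        u \<in> {0} \<and> v \<in> {p + q} \<or> u \<in> {p + q} \<and> v \<in> {0}"
      unfolding E lt by argo
  qed (use assms in \<open>auto simp: K_plus_def\<close>)
qed

text \<open>The ends of the path are the ends 0 and \<open>a\<close> of the deleted edge; between
  them lie the rest of the second part and the rest of the first. The sizes are
  \<open>1, b - 1, a - 1, 1\<close>.\<close>

lemma K_minus_P4_blowup:
  assumes "1 \<le> a" "1 \<le> b"
  shows "P4_blowup (K_minus_plus_isolated a b k) {0} {a + 1..<a + b} {1..<a} {a}"
proof -
  have E: "{u, v} \<in> snd (K_minus_plus_isolated a b k) \<longleftrightarrow>
      (u < a \<and> v \<in> {a..<a + b} \<or> u \<in> {a..<a + b} \<and> v < a) \<and>
      \<not> (u \<in> {0} \<and> v \<in> {a}) \<and> \<not> (u \<in> {a} \<and> v \<in> {0})" for u v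
    unfolding K_minus_plus_isolated_def by (auto simp: doubleton_eq_iff)
  have lt: "u < a \<longleftrightarrow> u \<in> {1..<a} \<or> u \<in> {0}" "u \<in> {a..<a + b} \<longleftrightarrow> u \<in> {a + 1..<a + b} \<or> u \<in> {a}" for u
    using assms by auto
  show ?thesis
    unfolding P4_blowup_def
  proof (intro conjI allI)
    fix u v
    have dis: "u \<in> {0} \<Longrightarrow> u \<notin> {1..<a} \<and> u \<notin> {a} \<and> u \<notin> {a + 1..<a + b}"
      "u \<in> {a} \<Longrightarrow> u \<notin> {1..<a} \<and> u \<notin> {a + 1..<a + b}" for u
      using assms by auto
    show "{u, v} \<in> snd (K_minus_plus_isolated a b k) \<longleftrightarrow>
        u \<in> {0} \<and> v \<in> {a + 1..<a + b} \<or> u \<in> {a + 1..<a + b} \<and> v \<in> {0} \<or>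
        u \<in> {a + 1..<a + b} \<and> v \<in> {1..<a} \<or> u \<in> {1..<a} \<and> v \<in> {a + 1..<a + b} \<or>
        u \<in> {1..<a} \<and> v \<in> {a} \<or> u \<in> {a} \<and> v \<in> {1..<a}"
      unfolding E lt using dis[of u] dis[of v] by argo
  qed (use assms in \<open>auto simp: K_minus_plus_isolated_def\<close>)
qed

section \<open>Bipartite graphs\<close>

lemma walks_nonneg: "0 \<le> walks G k u v"
  by (induction k arbitrary: u) (auto intro: sum_nonneg)

lemma simple_graph_edgeD:
  assumes "simple_graph G" "{u, v} \<in> snd G"
  shows "u < fst G" "v < fst G" "u \<noteq> v"
proof -
  obtain a b where "{u, v} = {a, b}" "a \<noteq> b" "a < fst G" "b < fst G"
    using assms unfolding simple_graph_def by blast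
  then show "u < fst G" "v < fst G" "u \<noteq> v" by (auto simp: doubleton_eq_iff)
qed

lemma walks_pos_if_relpow:
  assumes "simple_graph G" "(u, v) \<in> {(u, v). {u, v} \<in> snd G} ^^ k"
  shows "0 < walks G k u v"
  using assms(2)
proof (induction k arbitrary: u)
  case 0
  then show ?case by simp
next
  case (Suc k)
  then obtain y where y: "{u, y} \<in> snd G" "(y, v) \<in> {(u, v). {u, v} \<in> snd G} ^^ k"
    using relpow_Suc_D2[OF Suc.prems] by auto
  have "0 < of_bool ({u, y} \<in> snd G) * walks G k y v"
    using y Suc.IH by simp
  also have "\<dots> \<le> walks G (Suc k) u v"
    unfolding walks.simps using simple_graph_edgeD[OF assms(1) y(1)]
    by (intro member_le_sum) (auto simp: walks_nonneg)
  finally show ?case .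
qed

text \<open>Vertices are coloured by the parity of walks from a base point of their component. A
  clash along an edge would close up to an odd walk.\<close>

lemma bipartite_if_no_odd_closed_walks:
  assumes G: "simple_graph G" and odd: "\<And>k. odd k \<Longrightarrow> closed_walks G k = 0"
  obtains X where "X \<subseteq> {..<fst G}" "\<And>u v. {u, v} \<in> snd G \<Longrightarrow> u \<in> X \<longleftrightarrow> v \<notin> X"
proof -
  define R where "R = {(u, v). {u, v} \<in> snd G}"
  have symR: "(v, u) \<in> R" if "(u, v) \<in> R" for u v
    using that by (simp add: R_def insert_commute)
  have sympow: "(v, u) \<in> R ^^ k" if "(u, v) \<in> R ^^ k" for u v k
    using that
  proof (induction k arbitrary: v)
    case (Suc k)
    then show ?case by (meson relpow_Suc_E relpow_Suc_I2 symR)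
  qed auto
  have noodd: "(x, x) \<notin> R ^^ k" if k: "odd k" for x k
  proof
    assume x: "(x, x) \<in> R ^^ k"
    \<comment> \<open>An odd length is positive, so \<open>x\<close> lies on an edge and is a
      genuine vertex, one over which \<open>closed_walks\<close> sums.\<close>
    obtain j where "k = Suc j" using k by (cases k) auto
    then obtain y where "(x, y) \<in> R" using x relpow_Suc_D2 by metis
    then have "x < fst G" using simple_graph_edgeD[OF G] by (auto simp: R_def)
    then have "walks G k x x \<le> closed_walks G k"
      unfolding closed_walks_def by (intro member_le_sum) (auto simp: walks_nonneg)
    then show False
      using walks_pos_if_relpow[OF G] x odd[OF k] unfolding R_def by force
  qed
  \<comment> \<open>The least vertex of the component serves as its base point, so adjacent vertices
    share it.\<close>
  define rep where "rep v = (LEAST w. (w, v) \<in> R\<^sup>*)" for v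
  have rep: "(rep v, v) \<in> R\<^sup>*" for v
    unfolding rep_def by (rule LeastI[of _ v]) simp
  have rep_eq: "rep u = rep v" if "(u, v) \<in> R" for u v
  proof -
    have "(w, u) \<in> R\<^sup>* \<longleftrightarrow> (w, v) \<in> R\<^sup>*" for w
      using that symR by (meson rtrancl.rtrancl_into_rtrancl)
    then show ?thesis by (simp add: rep_def)
  qed
  define X where "X = {v. v < fst G \<and> (\<exists>k. even k \<and> (rep v, v) \<in> R ^^ k)}"
  have main: "u \<in> X \<longleftrightarrow> v \<notin> X" if "{u, v} \<in> snd G" for u v
  proof -
    have e: "(u, v) \<in> R" using that by (simp add: R_def)
    have lt: "u < fst G" "v < fst G" using simple_graph_edgeD[OF G that] by auto
    have no: "even k \<longleftrightarrow> odd l" if "(rep u, u) \<in> R ^^ k" "(rep v, v) \<in> R ^^ l" for k l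
    proof -
      have "(rep u, v) \<in> R ^^ Suc k" using that e by auto
      moreover have "(v, rep u) \<in> R ^^ l" using sympow[OF that(2)] rep_eq[OF e] by simp
      ultimately have "(rep u, rep u) \<in> R ^^ (Suc k + l)"
        unfolding relpow_add by blast
      then have "even (Suc k + l)" using noodd by blast
      then show ?thesis by auto
    qed
    obtain k l where "(rep u, u) \<in> R ^^ k" "(rep v, v) \<in> R ^^ l"
      using rep rtrancl_imp_relpow by metis
    then show ?thesis unfolding X_def using lt no by blast
  qed
  show ?thesis
    by (rule that[of X, OF _ main]) (auto simp: X_def)
qed

section \<open>Gram determinants of finite sets\<close>

text \<open>Determinants of the Gram matrices of 0/1 indicator vectors, whose inner products are the
  cardinalities of intersections.\<close>

definition gram2 :: "'b set \<Rightarrow> 'b set \<Rightarrow> real" where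
  "gram2 S T = real (card S) * real (card T) - (real (card (S \<inter> T)))\<^sup>2"

definition gram3 :: "'b set \<Rightarrow> 'b set \<Rightarrow> 'b set \<Rightarrow> real" where
  "gram3 S T U = real (card S) * real (card T) * real (card U)
     + 2 * real (card (S \<inter> T)) * real (card (T \<inter> U)) * real (card (U \<inter> S))
     - real (card S) * (real (card (T \<inter> U)))\<^sup>2 - real (card T) * (real (card (U \<inter> S)))\<^sup>2
     - real (card U) * (real (card (S \<inter> T)))\<^sup>2"

text \<open>Strict Cauchy-Schwarz for indicator vectors: distinct sets cannot both equal their
  intersection, so at least one cardinality strictly exceeds that of the intersection.\<close>

lemma gram2_pos:
  assumes "finite S" "finite T" "S \<noteq> {}" "T \<noteq> {}" "S \<noteq> T"
  shows "0 < gram2 S T"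
proof -
  have le: "card (S \<inter> T) \<le> card S" "card (S \<inter> T) \<le> card T"
    using assms by (auto intro: card_mono)
  have "card (S \<inter> T) < card S \<or> card (S \<inter> T) < card T"
    using assms le by (metis card_subset_eq inf_le1 inf_le2 le_neq_implies_less)
  moreover have "0 < card S" "0 < card T" using assms by (auto simp: card_gt_0_iff)
  ultimately have "card (S \<inter> T) * card (S \<inter> T) < card S * card T"
  proof (elim disjE)
    assume "card (S \<inter> T) < card S"
    then have "card (S \<inter> T) * card T < card S * card T" using \<open>0 < card T\<close> by simp
    then show ?thesis using mult_le_mono2[OF le(2), of "card (S \<inter> T)"] by linarith
  next
    assume "card (S \<inter> T) < card T"
    then have "card S * card (S \<inter> T) < card S * card T" using \<open>0 < card S\<close> by simp
    then show ?thesis using mult_le_mono1[OF le(1), of "card (S \<inter> T)"] by linarith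
  qed
  then have "real (card (S \<inter> T) * card (S \<inter> T)) < real (card S * card T)"
    by (simp only: of_nat_less_iff)
  then show ?thesis by (simp add: gram2_def power2_eq_square)
qed

text \<open>The coefficients \<open>c1, c2, c3\<close> are the first row of the adjugate of the Gram matrix, so the
  Gram matrix maps them to \<open>(gram3 S T U, 0, 0)\<close>.\<close>

lemma gram2_mult_gram3:
  assumes fin: "finite S" "finite T" "finite U"
  defines "c1 \<equiv> gram2 T U"
    and "c2 \<equiv> real (card (U \<inter> S)) * real (card (T \<inter> U)) - real (card (S \<inter> T)) * real (card U)"
    and "c3 \<equiv> real (card (S \<inter> T)) * real (card (T \<inter> U)) - real (card (U \<inter> S)) * real (card T)"
  shows "(\<Sum>y\<in>S \<union> T \<union> U. (c1 * of_bool (y \<in> S) + c2 * of_bool (y \<in> T) + c3 * of_bool (y \<in> U))\<^sup>2)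
    = gram2 T U * gram3 S T U"
proof -
  have card: "(\<Sum>y\<in>S \<union> T \<union> U. of_bool (y \<in> V)) = real (card V)" if "V \<subseteq> S \<union> T \<union> U" for V
    using that fin by (simp add: Int_absorb1)
  have "(\<Sum>y\<in>S \<union> T \<union> U. (c1 * of_bool (y \<in> S) + c2 * of_bool (y \<in> T) + c3 * of_bool (y \<in> U))\<^sup>2)
    = (\<Sum>y\<in>S \<union> T \<union> U. c1\<^sup>2 * of_bool (y \<in> S) + c2\<^sup>2 * of_bool (y \<in> T) + c3\<^sup>2 * of_bool (y \<in> U)
       + 2 * c1 * c2 * of_bool (y \<in> S \<inter> T) + 2 * c2 * c3 * of_bool (y \<in> T \<inter> U) + 2 * c1 * c3 * of_bool (y \<in> U \<inter> S))"
    by (rule sum.cong) (auto simp: power2_eq_square algebra_simps)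
  also have "\<dots> = c1\<^sup>2 * card S + c2\<^sup>2 * card T + c3\<^sup>2 * card U
       + 2 * c1 * c2 * card (S \<inter> T) + 2 * c2 * c3 * card (T \<inter> U) + 2 * c1 * c3 * card (U \<inter> S)"
    unfolding sum.distrib sum_distrib_left[symmetric]
    by (subst card, blast)+ (rule refl)
  also have "\<dots> = gram2 T U * gram3 S T U"
    unfolding c1_def c2_def c3_def gram2_def gram3_def by (simp add: algebra_simps power2_eq_square)
  finally show ?thesis .
qed

lemma gram3_nonneg:
  assumes fin: "finite S" "finite T" "finite U"
  shows "0 \<le> gram3 S T U"
proof (cases "T = {} \<or> U = {} \<or> T = U")
  case True
  \<comment> \<open>Here \<open>gram2 T U\<close> is zero and cannot be divided out, but
    \<open>gram3 S T U\<close> vanishes by direct computation.\<close>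
  then show ?thesis
    by (auto simp: gram3_def Int_commute power2_eq_square algebra_simps)
next
  case False
  then have "0 < gram2 T U" using gram2_pos fin by blast
  moreover have "0 \<le> gram2 T U * gram3 S T U"
    unfolding gram2_mult_gram3[OF fin, symmetric] by (intro sum_nonneg) simp
  ultimately show ?thesis by (simp add: zero_le_mult_iff)
qed

text \<open>The sum of squares in \<open>gram2_mult_gram3\<close> vanishes, so the indicator of
  \<open>S\<close> is a linear combination of those of \<open>T\<close> and \<open>U\<close>, with
  coefficients \<open>- c2 / c1\<close> and \<open>- c3 / c1\<close>. On each nonempty region among
  \<open>T - U\<close>, \<open>U - T\<close> and \<open>T \<inter> U\<close> its value is 0 or 1;
  distinctness leaves only a disjoint union or a proper difference.\<close>

lemma gram3_eq_0_imp:
  assumes fin: "finite S" "finite T" "finite U" and "gram3 S T U = 0"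
    and ne: "S \<noteq> {}" "T \<noteq> {}" "U \<noteq> {}" "S \<noteq> T" "S \<noteq> U" "T \<noteq> U"
  shows "S = T \<union> U \<and> T \<inter> U = {} \<or> T \<subset> U \<and> S = U - T \<or> U \<subset> T \<and> S = T - U"
proof -
  define c1 where "c1 = gram2 T U"
  define c2 where "c2 = real (card (U \<inter> S)) * real (card (T \<inter> U)) - real (card (S \<inter> T)) * real (card U)"
  define c3 where "c3 = real (card (S \<inter> T)) * real (card (T \<inter> U)) - real (card (U \<inter> S)) * real (card T)"
  have c1: "c1 \<noteq> 0" unfolding c1_def using gram2_pos[of T U] fin ne by simp
  have "(\<Sum>y\<in>S \<union> T \<union> U. (c1 * of_bool (y \<in> S) + c2 * of_bool (y \<in> T) + c3 * of_bool (y \<in> U))\<^sup>2) = 0"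
    unfolding c1_def c2_def c3_def gram2_mult_gram3[OF fin] using assms(4) by simp
  then have "\<forall>y\<in>S \<union> T \<union> U. (c1 * of_bool (y \<in> S) + c2 * of_bool (y \<in> T) + c3 * of_bool (y \<in> U))\<^sup>2 = 0"
    using fin by (subst (asm) sum_nonneg_eq_0_iff) auto
  then have lin: "c1 * of_bool (y \<in> S) + c2 * of_bool (y \<in> T) + c3 * of_bool (y \<in> U) = 0" for y
    by (cases "y \<in> S \<union> T \<union> U") auto
  have SU: "S \<subseteq> T \<union> U"
  proof
    fix y assume "y \<in> S"
    then show "y \<in> T \<union> U" using lin[of y] c1 by (cases "y \<in> T"; cases "y \<in> U") auto
  qed
  have onlyT: "y \<in> T - U \<Longrightarrow> (y \<in> S \<longleftrightarrow> c2 = - c1) \<and> (y \<notin> S \<longleftrightarrow> c2 = 0)" for y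
    using lin[of y] c1 by (cases "y \<in> S") auto
  have onlyU: "y \<in> U - T \<Longrightarrow> (y \<in> S \<longleftrightarrow> c3 = - c1) \<and> (y \<notin> S \<longleftrightarrow> c3 = 0)" for y
    using lin[of y] c1 by (cases "y \<in> S") auto
  have both: "y \<in> T \<inter> U \<Longrightarrow> (y \<in> S \<longleftrightarrow> c2 + c3 = - c1) \<and> (y \<notin> S \<longleftrightarrow> c2 + c3 = 0)" for y
    using lin[of y] c1 by (cases "y \<in> S") auto
  have rT: "T - U \<subseteq> S \<and> c2 = - c1 \<or> (T - U) \<inter> S = {} \<and> c2 = 0 \<or> T - U = {}" using onlyT by blast
  have rU: "U - T \<subseteq> S \<and> c3 = - c1 \<or> (U - T) \<inter> S = {} \<and> c3 = 0 \<or> U - T = {}" using onlyU by blast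
  have rB: "T \<inter> U \<subseteq> S \<and> c2 + c3 = - c1 \<or> (T \<inter> U) \<inter> S = {} \<and> c2 + c3 = 0 \<or> T \<inter> U = {}" using both by blast
  consider (ss) "T - U \<noteq> {}" "U - T \<noteq> {}" | (TU) "T \<subset> U" | (UT) "U \<subset> T" using ne by blast
  then show ?thesis
  proof cases
    case ss
    consider (a) "T - U \<subseteq> S" "c2 = - c1" "U - T \<subseteq> S" "c3 = - c1" | (b) "T - U \<subseteq> S" "c2 = - c1" "(U - T) \<inter> S = {}" "c3 = 0"
      | (c) "(T - U) \<inter> S = {}" "c2 = 0" "U - T \<subseteq> S" "c3 = - c1" | (d) "(T - U) \<inter> S = {}" "c2 = 0" "(U - T) \<inter> S = {}" "c3 = 0"
      using rT rU ss by blast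
    then show ?thesis
    proof cases
      case a
      then have "T \<inter> U = {}" using rB c1 by auto
      then show ?thesis using a SU by blast
    next
      case b
      then have "T \<inter> U \<subseteq> S \<or> T \<inter> U = {}" using rB c1 by auto
      then have "S = T" using b SU by blast
      then show ?thesis using ne by blast
    next
      case c
      then have "T \<inter> U \<subseteq> S \<or> T \<inter> U = {}" using rB c1 by auto
      then have "S = U" using c SU by blast
      then show ?thesis using ne by blast
    next
      case d
      then have "T \<inter> U \<inter> S = {} \<or> T \<inter> U = {}" using rB c1 by auto
      then have "S = {}" using d SU by blast
      then show ?thesis using ne by blast
    qed
  next
    case TU
    then have "U - T \<subseteq> S \<or> (U - T) \<inter> S = {}" "T \<subseteq> S \<or> T \<inter> S = {}" using rU rB by blast+
    then show ?thesis using TU SU ne by blast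
  next
    case UT
    then have "T - U \<subseteq> S \<or> (T - U) \<inter> S = {}" "U \<subseteq> S \<or> U \<inter> S = {}" using rT rB by blast+
    then show ?thesis using UT SU ne by blast
  qed
qed

lemma sum_of_three_types:
  fixes g :: "'b set \<Rightarrow> real"
  assumes X: "finite X" and N: "\<And>x. x \<in> X \<Longrightarrow> N x \<in> {{}, S, T, U}"
    and d: "S \<noteq> {}" "T \<noteq> {}" "U \<noteq> {}" "S \<noteq> T" "S \<noteq> U" "T \<noteq> U" and g: "g {} = 0"
  shows "(\<Sum>x\<in>X. g (N x)) = card {x \<in> X. N x = S} * g S + card {x \<in> X. N x = T} * g T + card {x \<in> X. N x = U} * g U"
proof -
  have card: "(\<Sum>x\<in>X. of_bool (N x = V) * g V) = card {x \<in> X. N x = V} * g V" for V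
  proof -
    have "(\<Sum>x\<in>X. of_bool (N x = V)) = real (card {x \<in> X. N x = V})"
      using X by (simp add: Int_def)
    then show ?thesis by (metis sum_distrib_right)
  qed
  have "(\<Sum>x\<in>X. g (N x)) = (\<Sum>x\<in>X. of_bool (N x = S) * g S + of_bool (N x = T) * g T + of_bool (N x = U) * g U)"
  proof (rule sum.cong[OF refl])
    fix x assume "x \<in> X"
    then consider "N x = {}" | "N x = S" | "N x = T" | "N x = U" using N by blast
    then show "g (N x) = of_bool (N x = S) * g S + of_bool (N x = T) * g T + of_bool (N x = U) * g U"
      using d g by cases auto
  qed
  then show ?thesis unfolding sum.distrib card .
qed

text \<open>Newton's identity: the principal 3 by 3 minors of \<open>M\<close>, summed over ordered
  triples, give six times the third elementary symmetric function of its eigenvalues.\<close>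

lemma sum_gram3:
  fixes M :: "'a \<Rightarrow> 'a \<Rightarrow> real" and X :: "'a set"
  assumes sym: "\<And>x y. M x y = M y x"
  defines "p1 \<equiv> (\<Sum>x\<in>X. M x x)" and "p2 \<equiv> (\<Sum>x\<in>X. \<Sum>y\<in>X. M x y * M y x)"
    and "p3 \<equiv> (\<Sum>x\<in>X. \<Sum>y\<in>X. \<Sum>z\<in>X. M x y * M y z * M z x)"
  shows "(\<Sum>x\<in>X. \<Sum>y\<in>X. \<Sum>z\<in>X. M x x * M y y * M z z + 2 * M x y * M y z * M z x
      - M x x * (M y z)\<^sup>2 - M y y * (M z x)\<^sup>2 - M z z * (M x y)\<^sup>2) = p1 ^ 3 - 3 * p1 * p2 + 2 * p3"
proof -
  have a: "(\<Sum>x\<in>X. \<Sum>y\<in>X. \<Sum>z\<in>X. M x x * M y y * M z z) = p1 ^ 3"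
    unfolding p1_def power3_eq_cube by (simp add: sum_distrib_left[symmetric] sum_distrib_right[symmetric] mult.assoc)
  have b: "(\<Sum>x\<in>X. \<Sum>y\<in>X. \<Sum>z\<in>X. 2 * M x y * M y z * M z x) = 2 * p3"
    unfolding p3_def by (simp add: sum_distrib_left mult.assoc)
  have p2: "p2 = (\<Sum>x\<in>X. \<Sum>y\<in>X. (M x y)\<^sup>2)"
    unfolding p2_def power2_eq_square by (intro sum.cong refl) (metis sym)
  have c: "(\<Sum>x\<in>X. \<Sum>y\<in>X. \<Sum>z\<in>X. M x x * (M y z)\<^sup>2) = p1 * p2"
    unfolding p1_def p2 by (simp add: sum_distrib_left[symmetric] sum_distrib_right[symmetric])
  have d: "(\<Sum>x\<in>X. \<Sum>y\<in>X. \<Sum>z\<in>X. M y y * (M z x)\<^sup>2) = p1 * p2"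
  proof -
    have "(\<Sum>x\<in>X. \<Sum>y\<in>X. \<Sum>z\<in>X. M y y * (M z x)\<^sup>2) = (\<Sum>y\<in>X. \<Sum>x\<in>X. \<Sum>z\<in>X. M y y * (M x z)\<^sup>2)"
      by (subst sum.swap) (intro sum.cong refl, metis sym)
    then show ?thesis unfolding c .
  qed
  have e: "(\<Sum>x\<in>X. \<Sum>y\<in>X. \<Sum>z\<in>X. M z z * (M x y)\<^sup>2) = p1 * p2"
    unfolding p1_def p2 by (simp add: sum_distrib_left[symmetric] sum_distrib_right[symmetric] mult.commute)
  show ?thesis unfolding sum_subtractf sum.distrib a b c d e by (simp add: algebra_simps)
qed

section \<open>Graphs with the moments of a blow-up\<close>

definition nbhd :: "graph \<Rightarrow> nat \<Rightarrow> nat set" where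
  "nbhd G u = {v. {u, v} \<in> snd G}"

lemma nbhd_subset: "simple_graph G \<Longrightarrow> nbhd G u \<subseteq> {..<fst G}"
  using simple_graph_edgeD(2)[of G u] by (auto simp: nbhd_def)

lemma walks_2:
  assumes G: "simple_graph G" and v: "v < fst G"
  shows "walks G 2 u v = card (nbhd G u \<inter> nbhd G v)"
proof -
  have "walks G 2 u v = walks G (Suc 1) u v" by (simp add: numeral_2_eq_2)
  also have "\<dots> = (\<Sum>z<fst G. of_bool ({u, z} \<in> snd G) * of_bool ({z, v} \<in> snd G))"
    unfolding walks.simps(2) walks_1[OF v] ..
  also have "\<dots> = (\<Sum>z<fst G. of_bool (z \<in> nbhd G u \<inter> nbhd G v))"
    by (rule sum.cong) (auto simp: nbhd_def insert_commute)
  also have "\<dots> = card ({..<fst G} \<inter> (nbhd G u \<inter> nbhd G v))"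
    by (simp add: Int_def)
  also have "{..<fst G} \<inter> (nbhd G u \<inter> nbhd G v) = nbhd G u \<inter> nbhd G v"
    using nbhd_subset[OF G] by blast
  finally show ?thesis .
qed

text \<open>Rotating a closed walk by one step exchanges those starting in \<open>X\<close> with
  those starting outside, so each kind makes up half.\<close>

lemma bipartite_closed_walks:
  assumes X: "X \<subseteq> {..<fst G}" and bip: "\<And>u v. {u, v} \<in> snd G \<Longrightarrow> u \<in> X \<longleftrightarrow> v \<notin> X"
  shows "closed_walks G (Suc j) = 2 * (\<Sum>v\<in>X. walks G (Suc j) v v)"
proof -
  let ?n = "fst G"
  have restrict: "sum f Z = (\<Sum>v<?n. of_bool (v \<in> Z) * f v)" if "Z \<subseteq> {..<?n}" for f :: "nat \<Rightarrow> real" and Z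
    using that by (intro sum.mono_neutral_cong_left) auto
  have "(\<Sum>v\<in>X. walks G (Suc j) v v)
      = (\<Sum>v<?n. \<Sum>z<?n. of_bool (v \<in> X) * (of_bool ({v, z} \<in> snd G) * walks G j z v))"
    unfolding restrict[OF X] walks.simps by (simp only: sum_distrib_left)
  also have "\<dots> = (\<Sum>v<?n. \<Sum>z<?n. of_bool (z \<notin> X) * (walks G j z v * of_bool ({v, z} \<in> snd G)))"
    by (intro sum.cong refl) (use bip in \<open>auto simp: of_bool_def\<close>)
  also have "\<dots> = (\<Sum>z<?n. \<Sum>v<?n. of_bool (z \<notin> X) * (walks G j z v * of_bool ({v, z} \<in> snd G)))"
    by (rule sum.swap)
  also have "\<dots> = (\<Sum>z<?n. of_bool (z \<in> {..<?n} - X) * walks G (Suc j) z z)"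
  proof (rule sum.cong[OF refl])
    fix z assume z: "z \<in> {..<?n}"
    then have "walks G (j + 1) z z = (\<Sum>v<?n. walks G j z v * of_bool ({v, z} \<in> snd G))"
      using walks_add[of z G j 1 z] walks_1[of z G] by simp
    then show "(\<Sum>v<?n. of_bool (z \<notin> X) * (walks G j z v * of_bool ({v, z} \<in> snd G)))
        = of_bool (z \<in> {..<?n} - X) * walks G (Suc j) z z"
      using z unfolding sum_distrib_left[symmetric] by simp
  qed
  also have "\<dots> = (\<Sum>z\<in>{..<?n} - X. walks G (Suc j) z z)"
    by (rule restrict[symmetric]) auto
  finally have "(\<Sum>v\<in>X. walks G (Suc j) v v) = (\<Sum>z\<in>{..<?n} - X. walks G (Suc j) z z)" .
  moreover have "closed_walks G (Suc j) = (\<Sum>z\<in>{..<?n} - X. walks G (Suc j) z z) + (\<Sum>v\<in>X. walks G (Suc j) v v)"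
    unfolding closed_walks_def by (rule sum.subset_diff[OF X]) simp
  ultimately show ?thesis by simp
qed

text \<open>\<open>M\<close> on \<open>X\<close> is the diagonal block of the squared adjacency
  matrix, so the even closed walk counts are twice the traces of powers of \<open>M\<close>.\<close>

lemma bipartite_moments:
  assumes G: "simple_graph G"
    and X: "X \<subseteq> {..<fst G}" and bip: "\<And>u v. {u, v} \<in> snd G \<Longrightarrow> u \<in> X \<longleftrightarrow> v \<notin> X"
  defines "M \<equiv> (\<lambda>x y. real (card (nbhd G x \<inter> nbhd G y)))"
  shows "closed_walks G 2 = 2 * (\<Sum>x\<in>X. M x x)"
    and "closed_walks G 4 = 2 * (\<Sum>x\<in>X. \<Sum>y\<in>X. M x y * M y x)"
    and "closed_walks G 6 = 2 * (\<Sum>x\<in>X. \<Sum>y\<in>X. \<Sum>z\<in>X. M x y * M y z * M z x)"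
proof -
  note cw = bipartite_closed_walks[OF X bip]
  have w2: "walks G 2 x y = M x y" if "y < fst G" for x y
    using walks_2[OF G that] by (simp add: M_def)
  have M0: "M x y = 0" if "x \<in> X" "y \<notin> X" for x y
  proof -
    have "nbhd G x \<inter> nbhd G y = {}" using bip that by (auto simp: nbhd_def)
    then show ?thesis by (simp add: M_def)
  qed
  have step: "walks G (2 + k) x v = (\<Sum>y\<in>X. M x y * walks G k y v)" if "x \<in> X" for x v k
  proof -
    have "walks G (2 + k) x v = (\<Sum>y<fst G. walks G 2 x y * walks G k y v)"
      by (rule walks_add) (use that X in auto)
    also have "\<dots> = (\<Sum>y<fst G. M x y * walks G k y v)"
      by (rule sum.cong) (auto simp: w2)
    also have "\<dots> = (\<Sum>y\<in>X. M x y * walks G k y v)"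
      by (rule sum.mono_neutral_right) (use X M0 that in auto)
    finally show ?thesis .
  qed
  have w4: "walks G 4 x v = (\<Sum>y\<in>X. M x y * M y v)" if "x \<in> X" "v \<in> X" for x v
  proof -
    have "v < fst G" using X that by auto
    then show ?thesis using step[OF that(1), of 2 v] by (simp add: w2)
  qed
  have w6: "walks G 6 x x = (\<Sum>y\<in>X. \<Sum>z\<in>X. M x y * M y z * M z x)" if "x \<in> X" for x
    using step[OF that, of 4 x] w4[OF _ that] by (simp add: sum_distrib_left mult.assoc)
  have "closed_walks G 2 = 2 * (\<Sum>x\<in>X. walks G 2 x x)"
    using cw[of 1] by (simp only: Suc_1)
  moreover have "walks G 2 x x = M x x" if "x \<in> X" for x using w2 X that by auto
  ultimately show "closed_walks G 2 = 2 * (\<Sum>x\<in>X. M x x)" by simp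
  have "closed_walks G 4 = 2 * (\<Sum>x\<in>X. walks G 4 x x)"
    using cw[of 3] by simp
  then show "closed_walks G 4 = 2 * (\<Sum>x\<in>X. \<Sum>y\<in>X. M x y * M y x)" using w4 by simp
  have "closed_walks G 6 = 2 * (\<Sum>x\<in>X. walks G 6 x x)"
    using cw[of 5] by simp
  then show "closed_walks G 6 = 2 * (\<Sum>x\<in>X. \<Sum>y\<in>X. \<Sum>z\<in>X. M x y * M y z * M z x)" using w6 by simp
qed

text \<open>Intended reading: \<open>a, b, c\<close> count the vertices with neighbourhoods
  \<open>S\<close>, \<open>T\<close>, \<open>S \<union> T\<close>, and \<open>x, y, k\<close> are
  the sizes of \<open>S - T\<close>, \<open>T - S\<close>, \<open>S \<inter> T\<close>. The bound
  then says that \<open>m\<close> is at most \<open>e + 1\<close>.\<close>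

lemma incomparable_types_bound:
  fixes a b c x y k :: real
  assumes "1 \<le> a" "1 \<le> b" "1 \<le> x" "1 \<le> y" "0 \<le> k" "0 \<le> c" "c = 0 \<or> k = 0"
  shows "a * (x + k) + b * (y + k) + c * (x + y)
    \<le> a * b * (x * y + k * x + k * y) + a * c * (x * y) + b * c * (x * y) + 1"
proof -
  \<comment> \<open>This accounts for the terms without \<open>k\<close> and \<open>c\<close>; the others are compared one by one.\<close>
  have 1: "0 \<le> (a * x - 1) * (b * y - 1)"
    using assms mult_mono[of 1 a 1 x] mult_mono[of 1 b 1 y] by (intro mult_nonneg_nonneg) auto
  have bx: "1 \<le> b * x" "1 \<le> a * y" using assms mult_mono[of 1 b 1 x] mult_mono[of 1 a 1 y] by auto
  have 2: "a * k * 1 \<le> a * k * (b * x)" "b * k * 1 \<le> b * k * (a * y)"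
    by (rule mult_left_mono; use assms bx in simp)+
  have 3: "c * x * 1 \<le> c * x * (a * y)" "c * y * 1 \<le> c * y * (b * x)"
    by (rule mult_left_mono; use assms bx in simp)+
  show ?thesis using 1 2 3 by (simp add: algebra_simps)
qed

lemma gram2_commute: "gram2 S T = gram2 T S"
  by (simp add: gram2_def Int_commute mult.commute)

text \<open>The assumption \<open>small\<close> is \<open>e + 1 < m\<close>, doubled. Two
  incomparable neighbourhoods \<open>S\<close>, \<open>T\<close> would, by linear dependence, leave
  only \<open>S\<close>, \<open>T\<close> and (if they are disjoint) \<open>S \<union> T\<close> as
  nonempty neighbourhoods, and then \<open>incomparable_types_bound\<close> contradicts
  \<open>small\<close>.\<close>

lemma nested_if_second_moment_small:
  fixes N :: "'a \<Rightarrow> 'b set" and X :: "'a set"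
  assumes X: "finite X" and fin: "\<And>x. x \<in> X \<Longrightarrow> finite (N x)"
    and g3: "\<And>x y z. x \<in> X \<Longrightarrow> y \<in> X \<Longrightarrow> z \<in> X \<Longrightarrow> gram3 (N x) (N y) (N z) = 0"
    and small: "(\<Sum>x\<in>X. \<Sum>y\<in>X. gram2 (N x) (N y)) + 2 < 2 * (\<Sum>x\<in>X. real (card (N x)))"
    and s: "s \<in> X" and t: "t \<in> X"
  shows "N s \<subseteq> N t \<or> N t \<subseteq> N s"
proof (rule ccontr)
  assume inc: "\<not> (N s \<subseteq> N t \<or> N t \<subseteq> N s)"
  define S where "S = N s"
  define T where "T = N t"
  define V where "V = S \<union> T"
  have finST: "finite S" "finite T" using fin s t by (auto simp: S_def T_def)
  have ne: "S \<noteq> {}" "T \<noteq> {}" "V \<noteq> {}" "S \<noteq> T" "S \<noteq> V" "T \<noteq> V" "\<not> S \<subset> T" "\<not> T \<subset> S"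
    using inc by (auto simp: S_def T_def V_def)
  have type: "N x \<in> {{}, S, T, V} \<and> (N x = V \<longrightarrow> S \<inter> T = {})" if "x \<in> X" for x
  proof (cases "N x \<in> {{}, S, T}")
    case True
    then show ?thesis using ne by auto
  next
    case False
    then show ?thesis
      using gram3_eq_0_imp[of "N x" S T] g3[OF that s t] fin[OF that] finST ne
      by (auto simp: S_def[symmetric] T_def[symmetric] V_def)
  qed
  define a where "a = card {x \<in> X. N x = S}"
  define b where "b = card {x \<in> X. N x = T}"
  define c where "c = card {x \<in> X. N x = V}"
  have sum3: "(\<Sum>x\<in>X. g (N x)) = a * g S + b * g T + c * g V" if "g {} = 0" for g :: "'b set \<Rightarrow> real"
    unfolding a_def b_def c_def using type ne that by (intro sum_of_three_types X) auto
  have g0: "gram2 {} W = 0" "gram2 W {} = 0" "gram2 W W = 0" for W :: "'b set"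
    by (simp_all add: gram2_def power2_eq_square)
  have m: "(\<Sum>x\<in>X. real (card (N x))) = real a * card S + real b * card T + real c * card V"
    by (rule sum3) simp
  have "(\<Sum>x\<in>X. \<Sum>y\<in>X. gram2 (N x) (N y)) = (\<Sum>x\<in>X. a * gram2 (N x) S + b * gram2 (N x) T + c * gram2 (N x) V)"
    by (intro sum.cong refl sum3) (simp add: g0)
  also have "\<dots> = a * (a * gram2 S S + b * gram2 S T + c * gram2 S V)
      + b * (a * gram2 T S + b * gram2 T T + c * gram2 T V) + c * (a * gram2 V S + b * gram2 V T + c * gram2 V V)"
    by (rule sum3) (simp add: g0)
  also have "\<dots> = 2 * (a * b * gram2 S T + a * c * gram2 S V + b * c * gram2 T V)"
    unfolding g0 gram2_commute[of T S] gram2_commute[of V S] gram2_commute[of V T] by (simp add: algebra_simps)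
  finally have e: "(\<Sum>x\<in>X. \<Sum>y\<in>X. gram2 (N x) (N y)) = 2 * (a * b * gram2 S T + a * c * gram2 S V + b * c * gram2 T V)" .
  define x where "x = card (S - T)"
  define y where "y = card (T - S)"
  define k where "k = card (S \<inter> T)"
  have cS: "card S = x + k" and cT: "card T = y + k"
    using card_Int_Diff[OF finST(1), of T] card_Int_Diff[OF finST(2), of S]
    by (auto simp: x_def y_def k_def Int_commute)
  have V: "card V = x + y + k"
    using card_Un_Int[OF finST] cS cT by (simp add: V_def k_def)
  have xy: "1 \<le> x" "1 \<le> y"
    using inc finST by (auto simp: x_def y_def S_def T_def Suc_le_eq card_gt_0_iff)
  have ab: "1 \<le> a" "1 \<le> b"
    using s t X by (auto simp: a_def b_def S_def T_def Suc_le_eq card_gt_0_iff)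
  \<comment> \<open>The union occurs as a neighbourhood only when \<open>S\<close> and
    \<open>T\<close> are disjoint.\<close>
  have ck: "c = 0 \<or> k = 0"
  proof (cases "\<exists>x\<in>X. N x = V")
    case True
    then show ?thesis using type by (auto simp: k_def)
  next
    case False
    then have "{x \<in> X. N x = V} = {}" by blast
    then show ?thesis unfolding c_def by (metis card.empty)
  qed
  have int: "S \<inter> V = S" "T \<inter> V = T" by (auto simp: V_def)
  have gs: "gram2 S T = real x * y + real k * x + real k * y"
    "gram2 S V = (real x + k) * y" "gram2 T V = (real y + k) * x"
    unfolding gram2_def int cS cT V k_def[symmetric] by (simp_all add: algebra_simps power2_eq_square)
  have "real a * (real x + k) + real b * (real y + k) + real c * (real x + y)
    \<le> real a * b * (real x * y + real k * x + real k * y) + real a * c * (real x * y) + real b * c * (real x * y) + 1"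
    by (rule incomparable_types_bound) (use xy ab ck in auto)
  then show False
    using small ck unfolding m e gs cS cT V by (auto simp: algebra_simps)
qed

lemma P4_blowup_if_closed_walks:
  fixes m e :: real
  assumes G: "simple_graph G" and odd: "\<And>k. odd k \<Longrightarrow> closed_walks G k = 0"
    and c2: "closed_walks G 2 = 2 * m" and c4: "closed_walks G 4 = 2 * (m\<^sup>2 - 2 * e)"
    and c6: "closed_walks G 6 = 2 * (m ^ 3 - 3 * m * e)"
    and e: "0 < e" "e + 1 < m"
  obtains A B C D where "P4_blowup G A B C D" "A \<noteq> {}" "B \<noteq> {}" "C \<noteq> {}" "D \<noteq> {}"
proof -
  obtain X where X: "X \<subseteq> {..<fst G}" and bip: "\<And>u v. {u, v} \<in> snd G \<Longrightarrow> u \<in> X \<longleftrightarrow> v \<notin> X"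
    using bipartite_if_no_odd_closed_walks[OF G odd] by blast
  define N where "N = nbhd G"
  define M where "M x y = real (card (N x \<inter> N y))" for x y
  have finX: "finite X" using X finite_subset by blast
  have finN: "finite (N x)" for x
    unfolding N_def using nbhd_subset[OF G] finite_subset by blast
  have p1: "(\<Sum>x\<in>X. M x x) = m"
    using bipartite_moments(1)[OF G X bip] c2 by (simp add: M_def N_def)
  have p2: "(\<Sum>x\<in>X. \<Sum>y\<in>X. M x y * M y x) = m\<^sup>2 - 2 * e"
    using bipartite_moments(2)[OF G X, folded N_def, folded M_def] bip c4 by simp
  have p3: "(\<Sum>x\<in>X. \<Sum>y\<in>X. \<Sum>z\<in>X. M x y * M y z * M z x) = m ^ 3 - 3 * m * e"
    using bipartite_moments(3)[OF G X, folded N_def, folded M_def] bip c6 by simp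
  have "(\<Sum>x\<in>X. \<Sum>y\<in>X. \<Sum>z\<in>X. gram3 (N x) (N y) (N z))
      = (\<Sum>x\<in>X. \<Sum>y\<in>X. \<Sum>z\<in>X. M x x * M y y * M z z + 2 * M x y * M y z * M z x
      - M x x * (M y z)\<^sup>2 - M y y * (M z x)\<^sup>2 - M z z * (M x y)\<^sup>2)"
    by (simp add: gram3_def M_def)
  \<comment> \<open>The three moments are the power sums of two numbers with sum \<open>m\<close>
    and product \<open>e\<close>, so the third elementary symmetric function is zero.\<close>
  also have "\<dots> = m ^ 3 - 3 * m * (m\<^sup>2 - 2 * e) + 2 * (m ^ 3 - 3 * m * e)"
    by (subst sum_gram3) (simp_all only: p1 p2 p3, simp add: M_def Int_commute)
  also have "\<dots> = 0" by (simp add: algebra_simps power2_eq_square power3_eq_cube)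
  finally have g3sum: "(\<Sum>x\<in>X. \<Sum>y\<in>X. \<Sum>z\<in>X. gram3 (N x) (N y) (N z)) = 0" .
  note nn = gram3_nonneg[OF finN finN finN]
  have g3: "gram3 (N x) (N y) (N z) = 0" if "x \<in> X" "y \<in> X" "z \<in> X" for x y z
  proof -
    have "(\<Sum>y\<in>X. \<Sum>z\<in>X. gram3 (N x) (N y) (N z)) = 0"
      using g3sum that(1) finX by (subst (asm) sum_nonneg_eq_0_iff) (auto intro!: sum_nonneg nn)
    then have "(\<Sum>z\<in>X. gram3 (N x) (N y) (N z)) = 0"
      using that(2) finX by (subst (asm) sum_nonneg_eq_0_iff) (auto intro!: sum_nonneg nn)
    then show ?thesis
      using that(3) finX by (subst (asm) sum_nonneg_eq_0_iff) (auto intro!: nn)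
  qed
  \<comment> \<open>The analogue for pairs: twice the second elementary symmetric function.\<close>
  have g2: "(\<Sum>x\<in>X. \<Sum>y\<in>X. gram2 (N x) (N y)) = 2 * e"
  proof -
    have "(\<Sum>x\<in>X. \<Sum>y\<in>X. gram2 (N x) (N y)) = (\<Sum>x\<in>X. \<Sum>y\<in>X. M x x * M y y - M x y * M y x)"
      by (simp add: gram2_def M_def power2_eq_square Int_commute)
    also have "\<dots> = (\<Sum>x\<in>X. M x x) * (\<Sum>y\<in>X. M y y) - (\<Sum>x\<in>X. \<Sum>y\<in>X. M x y * M y x)"
      unfolding sum_subtractf sum_product ..
    finally show ?thesis unfolding p1 p2 by (simp add: power2_eq_square)
  qed
  have nested: "N x \<subseteq> N y \<or> N y \<subseteq> N x" if "x \<in> X" "y \<in> X" for x y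
  proof (rule nested_if_second_moment_small[OF finX finN g3 _ that])
    have "(\<Sum>x\<in>X. real (card (N x))) = m" using p1 by (simp add: M_def)
    then show "(\<Sum>x\<in>X. \<Sum>y\<in>X. gram2 (N x) (N y)) + 2 < 2 * (\<Sum>x\<in>X. real (card (N x)))"
      using g2 e by simp
  qed
  have "\<exists>x\<in>X. \<exists>y\<in>X. gram2 (N x) (N y) \<noteq> 0"
  proof (rule ccontr)
    assume "\<not> ?thesis"
    then have "(\<Sum>x\<in>X. \<Sum>y\<in>X. gram2 (N x) (N y)) = 0" by simp
    then show False using g2 e by simp
  qed
  then obtain x y where xy: "x \<in> X" "y \<in> X" "gram2 (N x) (N y) \<noteq> 0" by blast
  then have "N x \<noteq> N y" "N x \<noteq> {}" "N y \<noteq> {}"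
    by (auto simp: gram2_def power2_eq_square)
  then obtain s t where st: "s \<in> X" "t \<in> X" "N s \<noteq> {}" "N s \<subset> N t"
    using nested[OF xy(1,2)] xy(1,2) by blast
  define S where "S = N s"
  define T where "T = N t"
  have ST: "S \<noteq> {}" "S \<subset> T" using st by (auto simp: S_def T_def)
  have types: "N z = {} \<or> N z = S \<or> N z = T" if z: "z \<in> X" for z
  proof (rule ccontr)
    assume a: "\<not> ?thesis"
    \<comment> \<open>Since \<open>S\<close> is nonempty and inside \<open>T\<close>, the two are
      not disjoint, and \<open>T - S\<close> is the only dependent set left; it is incomparable with
      \<open>S\<close>.\<close>
    then have "N z = T - S"
      using gram3_eq_0_imp[of "N z" S T] g3[OF z st(1,2)] finN ST
      unfolding S_def T_def by blast
    then show False using nested[OF z st(1)] ST unfolding S_def[symmetric] by blast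
  qed
  have TX: "v \<notin> X" "v < fst G" if "v \<in> T" for v
    using that bip st(2) simple_graph_edgeD[OF G] by (auto simp: T_def N_def nbhd_def)
  have edge: "{u, v} \<in> snd G \<longleftrightarrow> u \<in> X \<and> v \<in> N u \<or> v \<in> X \<and> u \<in> N v" for u v
    using bip[of u v] by (auto simp: N_def nbhd_def insert_commute)
  define A where "A = {x \<in> X. N x = S}"
  define C where "C = {x \<in> X. N x = T}"
  have half: "u \<in> X \<and> v \<in> N u \<longleftrightarrow> u \<in> A \<and> v \<in> S \<or> u \<in> C \<and> v \<in> S \<or> u \<in> C \<and> v \<in> T - S" for u v
    using types[of u] ST by (auto simp: A_def C_def)
  \<comment> \<open>The classes alternate between the two colours: \<open>A\<close> and
    \<open>C\<close> lie in \<open>X\<close> and are grouped by neighbourhood, while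
    \<open>S\<close> and \<open>T - S\<close> lie outside.\<close>
  have "P4_blowup G A S C (T - S)"
    unfolding P4_blowup_def
  proof (intro conjI allI)
    fix u v
    show "{u, v} \<in> snd G \<longleftrightarrow>
        u \<in> A \<and> v \<in> S \<or> u \<in> S \<and> v \<in> A \<or> u \<in> S \<and> v \<in> C \<or> u \<in> C \<and> v \<in> S \<or>
        u \<in> C \<and> v \<in> T - S \<or> u \<in> T - S \<and> v \<in> C"
      unfolding edge half by argo
  qed (use TX X ST in \<open>auto simp: A_def C_def\<close>)
  moreover have "A \<noteq> {}" "C \<noteq> {}" using st by (auto simp: A_def C_def S_def T_def)
  ultimately show ?thesis using that[of A S C "T - S"] ST by blast
qed

section \<open>Graphs cospectral with the complete bipartite graph plus a pendant edge\<close>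

lemma P4_blowup_closed_walks_odd:
  assumes "P4_blowup G A B C D" "odd k"
  shows "closed_walks G k = 0"
  using assms(2)
proof (induction k rule: less_induct)
  case (less k)
  show ?case
  proof (cases "k < 5")
    case True
    then have "k = 1 \<or> k = 3" using less.prems by presburger
    then show ?thesis using P4_blowup_closed_walks_small(2,4)[OF assms(1)] by auto
  next
    case False
    then obtain j where j: "k = j + 5" using le_iff_add[of 5 k] by (auto simp: not_less)
    then have "closed_walks G (j + 3) = 0" "closed_walks G (j + 1) = 0"
      using less.IH[of "j + 3"] less.IH[of "j + 1"] less.prems by auto
    then show ?thesis
      unfolding j P4_blowup_closed_walks_rec[OF assms(1)] by simp
  qed
qed

section \<open>Integer solutions for the class sizes\<close>

text \<open>If both end classes had size at least 2, the edge number would be at most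
  \<open>a * b * c * d + 1\<close>, whereas the equations make it exceed this by \<open>q\<close>.
  Subtracting the lower bounds from the sizes turns the inequality into a comparison of
  coefficients.\<close>

lemma P4_sizes_end_eq_1:
  fixes a b c d p q :: nat
  assumes pos: "1 \<le> a" "1 \<le> b" "1 \<le> c" "1 \<le> d" and q: "1 \<le> q"
    and m: "a * b + b * c + c * d = p * q + 1" and e: "a * b * c * d + q = p * q"
  shows "a = 1 \<or> d = 1"
proof (rule ccontr)
  assume "\<not> ?thesis"
  then obtain a' b' c' d' where "a = a' + 2" "b = b' + 1" "c = c' + 1" "d = d' + 2"
    using pos by (metis One_nat_def Suc_1 add.commute le_add_diff_inverse le_antisym not_less_eq_eq)
  then have "a * b + b * c + c * d \<le> a * b * c * d + 1"
    by (simp add: algebra_simps)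
  then show False using m e q by linarith
qed

text \<open>The case \<open>c = 1\<close> yields the sizes of \<open>K_plus\<close>. The case
  \<open>a = 1\<close> yields Vieta's formulas for the roots \<open>b + 1\<close> and
  \<open>c + 1\<close> of the quadratic. If both are at least 2, the same comparison gives
  \<open>q \<le> 1\<close>.\<close>

lemma P4_sizes_if_last_eq_1:
  fixes a b c p q :: nat
  assumes pos: "1 \<le> a" "1 \<le> b" "1 \<le> c" and q: "2 \<le> q" and p: "1 \<le> p"
    and m: "a * b + b * c + c = p * q + 1" and e: "a * b * c + q = p * q"
  shows "a = p - 1 \<and> b = q \<and> c = 1 \<or> a = 1 \<and> b + c + 2 = q + 3 \<and> (b + 1) * (c + 1) = p * q + 2"
proof (cases "a = 1")
  case True
  then show ?thesis using m e by (simp add: algebra_simps)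
next
  case a: False
  show ?thesis
  proof (cases "c = 1")
    case True
    then have "b = q" using m e by simp
    moreover have "a * q + q = p * q" using e True \<open>b = q\<close> by simp
    then have "(a + 1) * q = p * q" by simp
    then have "a + 1 = p" using q by (simp only: mult_cancel2) simp
    ultimately show ?thesis using True by auto
  next
    case False
    then obtain a' b' c' where "a = a' + 2" "b = b' + 1" "c = c' + 2"
      using pos a by (metis One_nat_def Suc_1 add.commute le_add_diff_inverse le_antisym not_less_eq_eq)
    then have "a * b + b * c + c \<le> a * b * c + 2"
      by (simp add: algebra_simps)
    then show ?thesis using m e q by linarith
  qed
qed

text \<open>Both orders of the parts are recorded because \<open>b\<close> and \<open>c\<close> come
  unordered, whereas the roots in the theorem are sorted.\<close>

lemma cospectral_K_plus_imp:
  assumes pq: "3 \<le> p" "p \<le> q" and G: "simple_graph G" and cosp: "cospectral G (K_plus p q)"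
  shows "graph_iso G (K_plus p q) \<or>
    (\<exists>b c. 1 \<le> b \<and> 1 \<le> c \<and> b + c + 2 = q + 3 \<and> (b + 1) * (c + 1) = p * q + 2 \<and>
      graph_iso G (K_minus_plus_isolated (b + 1) (c + 1) (p - 2)) \<and>
      graph_iso G (K_minus_plus_isolated (c + 1) (b + 1) (p - 2)))"
proof -
  let ?K = "K_plus p q"
  have K: "P4_blowup ?K {1..<p} {p..<p + q} {0} {p + q}" using K_plus_P4_blowup pq by simp
  define m where "m = real (p * q + 1)"
  define e where "e = real ((p - 1) * q)"
  obtain r where r: "p = Suc r" using pq by (cases p) auto
  have mK: "real (P4_edges (card {1..<p}) (card {p..<p + q}) (card {0::nat}) (card {p + q})) = m"
    by (simp add: P4_edges_def m_def r algebra_simps)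
  have eK: "real (card {1..<p} * card {p..<p + q} * card {0::nat} * card {p + q}) = e"
    by (simp add: e_def)
  have cw: "closed_walks G = closed_walks ?K" using cosp cospectral_iff_closed_walks by blast
  note small = P4_blowup_closed_walks_small[OF K, unfolded mK eK]
  have n: "fst G = p + q + 1"
    using fun_cong[OF cw, of 0] small(1) by (simp add: closed_walks_def K_plus_def)
  \<comment> \<open>Length 6 is the first even length beyond the initial values; the recurrence
    supplies it.\<close>
  have "closed_walks ?K 6 = m * closed_walks ?K 4 - e * closed_walks ?K 2"
    using P4_blowup_closed_walks_rec[OF K, of 1, unfolded mK eK] by (simp add: numeral_2_eq_2)
  then have "closed_walks ?K 6 = 2 * (m ^ 3 - 3 * m * e)"
    unfolding small by (simp add: algebra_simps power2_eq_square power3_eq_cube)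
  moreover have "0 < e" "e + 1 < m" using pq by (auto simp: e_def m_def r algebra_simps)
  moreover have "\<And>k. odd k \<Longrightarrow> closed_walks ?K k = 0" using P4_blowup_closed_walks_odd[OF K] .
  ultimately obtain A B C D where bl: "P4_blowup G A B C D" and ne: "A \<noteq> {}" "B \<noteq> {}" "C \<noteq> {}" "D \<noteq> {}"
    using P4_blowup_if_closed_walks[OF G, of m e] small(3,5) unfolding cw by metis
  define a b c d where "a = card A" and "b = card B" and "c = card C" and "d = card D"
  note defs = a_def b_def c_def d_def
  note smallG = P4_blowup_closed_walks_small[OF bl, folded defs, unfolded cw small]
  have m': "real (P4_edges a b c d) = m" using smallG(3) by simp
  have e': "real (a * b * c * d) = e" using smallG(5) unfolding m' by simp
  have mm: "a * b + b * c + c * d = p * q + 1"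
    using m' unfolding m_def P4_edges_def of_nat_eq_iff .
  have ee: "a * b * c * d + q = p * q"
    using e' unfolding e_def of_nat_eq_iff by (simp add: r)
  have pos: "1 \<le> a" "1 \<le> b" "1 \<le> c" "1 \<le> d"
    using ne P4_blowup_finite[OF bl] by (auto simp: defs Suc_le_eq card_gt_0_iff)
  \<comment> \<open>Stated for arbitrary classes so that it also applies to the path read backwards,
    when the first class is the singleton.\<close>
  have main: ?thesis
    if bl: "P4_blowup G A B C D" and cd: "card A = a" "card B = b" "card C = c" "card D = 1"
      and pos: "1 \<le> a" "1 \<le> b" "1 \<le> c"
      and m: "a * b + b * c + c = p * q + 1" and e: "a * b * c + q = p * q" for A B C D a b c
  proof -
    from P4_sizes_if_last_eq_1[OF pos _ _ m e] pq
    have "a = p - 1 \<and> b = q \<and> c = 1 \<or> a = 1 \<and> b + c + 2 = q + 3 \<and> (b + 1) * (c + 1) = p * q + 2" by simp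
    then show ?thesis
    proof
      assume "a = p - 1 \<and> b = q \<and> c = 1"
      then have "graph_iso G ?K"
        by (intro P4_blowup_iso[OF bl K]) (simp_all add: cd n, simp add: K_plus_def)
      then show ?thesis ..
    next
      assume *: "a = 1 \<and> b + c + 2 = q + 3 \<and> (b + 1) * (c + 1) = p * q + 2"
      \<comment> \<open>The \<open>p - 2\<close> isolated vertices make up the count:
        \<open>(q + 3) + (p - 2) = p + q + 1\<close>.\<close>
      have n': "fst G = fst (K_minus_plus_isolated (x + 1) (y + 1) (p - 2))" if "x + y = b + c" for x y
        using * that n pq by (simp add: K_minus_plus_isolated_def)
      have "graph_iso G (K_minus_plus_isolated (c + 1) (b + 1) (p - 2))"
        by (rule P4_blowup_iso[OF bl K_minus_P4_blowup n']) (use * cd in auto)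
      moreover have "graph_iso G (K_minus_plus_isolated (b + 1) (c + 1) (p - 2))"
        by (rule P4_blowup_iso[OF P4_blowup_sym[OF bl] K_minus_P4_blowup n']) (use * cd in auto)
      ultimately show ?thesis using * pos by blast
    qed
  qed
  have "a = 1 \<or> d = 1"
    using P4_sizes_end_eq_1[OF pos _ mm ee] pq by simp
  then show ?thesis
  proof
    assume "d = 1"
    then show ?thesis using main[OF bl, of a b c] pos mm ee by (simp add: defs)
  next
    assume "a = 1"
    then show ?thesis
      using main[OF P4_blowup_sym[OF bl], of d c b] pos mm ee by (simp add: defs algebra_simps)
  qed
qed

section \<open>The cospectral mate and the quadratic equation\<close>

lemma simple_graph_K_minus: "simple_graph (K_minus_plus_isolated a b k)"
  unfolding simple_graph_def K_minus_plus_isolated_def by fastforce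

text \<open>With sizes \<open>1, b - 1, a - 1, 1\<close> the edge number is
  \<open>a * b - 1 = p * q + 1\<close>, and the product of sizes is
  \<open>a * b - (a + b) + 1 = (p - 1) * q\<close>, as for \<open>K_plus\<close>.\<close>

lemma K_minus_cospectral_K_plus:
  assumes pq: "3 \<le> p" "p \<le> q" and s: "1 \<le> a" "1 \<le> b" "a + b = q + 3" "a * b = p * q + 2"
  shows "cospectral (K_minus_plus_isolated a b (p - 2)) (K_plus p q)"
proof -
  obtain a' b' r where r: "a = Suc a'" "b = Suc b'" "p = Suc r"
    using s pq by (metis Suc_le_D One_nat_def numeral_3_eq_3)
  have 1: "a' + b' = q + 1" using s(3) r by simp
  have 2: "a' * b' = r * q" using s(4) 1 r by simp
  have "closed_walks (K_minus_plus_isolated a b (p - 2)) k = closed_walks (K_plus p q) k" for k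
  proof (rule P4_blowup_closed_walks_eq[OF K_minus_P4_blowup K_plus_P4_blowup])
    show "fst (K_minus_plus_isolated a b (p - 2)) = fst (K_plus p q)"
      using s pq by (simp add: K_minus_plus_isolated_def K_plus_def)
    have cards: "card {a + 1..<a + b} = b'" "card {1..<a} = a'" "card {1..<p} = r" by (simp_all add: r)
    show "P4_edges (card {0::nat}) (card {a + 1..<a + b}) (card {1..<a}) (card {a})
        = P4_edges (card {1..<p}) (card {p..<p + q}) (card {0::nat}) (card {p + q})"
      unfolding cards P4_edges_def using 1 2 mult.commute[of a' b'] by auto
    show "card {0::nat} * card {a + 1..<a + b} * card {1..<a} * card {a}
        = card {1..<p} * card {p..<p + q} * card {0::nat} * card {p + q}"
      unfolding cards using 2 mult.commute[of a' b'] by auto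
  qed (use s pq in auto)
  then show ?thesis unfolding cospectral_iff_closed_walks by blast
qed

text \<open>Vertex \<open>a + b\<close> is isolated on the left, whereas no vertex of
  \<open>K_plus\<close> is. For \<open>k = p - 2\<close>, the bound on \<open>k\<close> comes from
  \<open>3 \<le> p\<close>.\<close>

lemma K_minus_not_iso_K_plus:
  assumes "1 \<le> p" "1 \<le> q" "1 \<le> k"
  shows "\<not> graph_iso (K_minus_plus_isolated a b k) (K_plus p q)"
proof
  let ?H = "K_minus_plus_isolated a b k" and ?K = "K_plus p q"
  assume "graph_iso ?H ?K"
  then obtain f where f: "bij_betw f {0..<fst ?H} {0..<fst ?K}"
    and ed: "\<And>u v. u < fst ?H \<Longrightarrow> v < fst ?H \<Longrightarrow> {u, v} \<in> snd ?H \<longleftrightarrow> {f u, f v} \<in> snd ?K"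
    unfolding graph_iso_def by blast
  have x: "a + b < fst ?H" using assms by (simp add: K_minus_plus_isolated_def)
  then have fx: "f (a + b) < p + q + 1" using bij_betwE[OF f] by (auto simp: K_plus_def)
  have K: "P4_blowup ?K {1..<p} {p..<p + q} {0} {p + q}" using K_plus_P4_blowup assms by simp
  \<comment> \<open>A neighbour of any vertex: \<open>p\<close> for the first part, and 0 for both
    the second part and the pendant vertex.\<close>
  define w where "w = (if f (a + b) < p then p else 0)"
  have w: "{f (a + b), w} \<in> snd ?K" "w < fst ?K"
    unfolding P4_blowup_edge_iff[OF K] using fx assms by (auto simp: w_def K_plus_def)
  then obtain v where v: "v < fst ?H" "f v = w"
    using f unfolding bij_betw_def by (metis atLeastLessThan_iff imageE zero_le)
  then have "{a + b, v} \<in> snd ?H" using ed[OF x v(1)] w by simp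
  then show False by (auto simp: K_minus_plus_isolated_def doubleton_eq_iff)
qed

text \<open>Vieta's formulas, obtained by evaluating at 0 and 1. Stating the factorisation as an
  identity of functions covers a double root as well.\<close>

lemma quadratic_roots_iff:
  fixes p q a b :: nat
  shows "(\<forall>x::real. x\<^sup>2 - (real q + 3) * x + (real p * real q + 2) = (x - real a) * (x - real b))
    \<longleftrightarrow> a + b = q + 3 \<and> a * b = p * q + 2" (is "?L \<longleftrightarrow> ?R")
proof
  assume ?L
  from this[rule_format, of 0] this[rule_format, of 1]
  have "real (a * b) = real (p * q + 2)" "real (a + b) = real (q + 3)"
    by (simp_all add: algebra_simps)
  then show ?R by (simp only: of_nat_eq_iff)
next
  assume ?R
  then have "real (a * b) = real (p * q + 2)" "real (a + b) = real (q + 3)" by simp_all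
  then have 1: "real a * real b = real p * real q + 2" and 2: "real q + 3 = real a + real b" by simp_all
  show ?L unfolding 1[symmetric] 2 by (simp add: algebra_simps power2_eq_square)
qed

theorem theorem4p1:
  fixes p q :: nat
  assumes "3 \<le> p" and "p \<le> q"
  shows "(\<not> determined_by_spectrum (K_plus p q) \<longleftrightarrow>
          (\<exists>p'' q'' :: nat. 2 \<le> p'' \<and> p'' \<le> q'' \<and>
             (\<forall>x::real. x\<^sup>2 - (real q + 3) * x + (real p * real q + 2)
                         = (x - real p'') * (x - real q''))))
       \<and> (\<not> determined_by_spectrum (K_plus p q) \<longrightarrow>
          (\<forall>p'' q'' :: nat. 2 \<le> p'' \<and> p'' \<le> q'' \<and>
             (\<forall>x::real. x\<^sup>2 - (real q + 3) * x + (real p * real q + 2)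
                         = (x - real p'') * (x - real q'')) \<longrightarrow>
             (let H = K_minus_plus_isolated p'' q'' (p - 2) in
                cospectral H (K_plus p q) \<and> \<not> graph_iso H (K_plus p q) \<and>
                (\<forall>G. simple_graph G \<longrightarrow> cospectral G (K_plus p q) \<longrightarrow>
                     \<not> graph_iso G (K_plus p q) \<longrightarrow> graph_iso G H))))"
  unfolding quadratic_roots_iff Let_def
proof (intro conjI impI allI iffI)
  assume "\<not> determined_by_spectrum (K_plus p q)"
  then obtain G where "simple_graph G" "cospectral G (K_plus p q)" "\<not> graph_iso G (K_plus p q)"
    unfolding determined_by_spectrum_def by blast
  then obtain b c where "1 \<le> b" "1 \<le> c" "b + c + 2 = q + 3" "(b + 1) * (c + 1) = p * q + 2"
    using cospectral_K_plus_imp[OF assms] by blast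
  \<comment> \<open>The sizes \<open>b + 1\<close> and \<open>c + 1\<close> come unordered;
    \<open>min\<close> and \<open>max\<close> sort them.\<close>
  then have "2 \<le> min (b + 1) (c + 1) \<and> min (b + 1) (c + 1) \<le> max (b + 1) (c + 1) \<and>
      min (b + 1) (c + 1) + max (b + 1) (c + 1) = q + 3 \<and> min (b + 1) (c + 1) * max (b + 1) (c + 1) = p * q + 2"
    by (auto simp: min_def max_def mult.commute)
  then show "\<exists>p'' q''. 2 \<le> p'' \<and> p'' \<le> q'' \<and> p'' + q'' = q + 3 \<and> p'' * q'' = p * q + 2"
    by blast
next
  have K: "cospectral (K_minus_plus_isolated a b (p - 2)) (K_plus p q)"
    "\<not> graph_iso (K_minus_plus_isolated a b (p - 2)) (K_plus p q)"
    if "2 \<le> a \<and> a \<le> b \<and> a + b = q + 3 \<and> a * b = p * q + 2" for a b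
    using that K_minus_cospectral_K_plus[OF assms, of a b] K_minus_not_iso_K_plus[of p q "p - 2" a b] assms
    by auto
  show "\<not> determined_by_spectrum (K_plus p q)"
    if "\<exists>p'' q''. 2 \<le> p'' \<and> p'' \<le> q'' \<and> p'' + q'' = q + 3 \<and> p'' * q'' = p * q + 2"
    using that K simple_graph_K_minus unfolding determined_by_spectrum_def by blast
  fix a b :: nat
  assume ab: "2 \<le> a \<and> a \<le> b \<and> a + b = q + 3 \<and> a * b = p * q + 2"
  show "cospectral (K_minus_plus_isolated a b (p - 2)) (K_plus p q)"
    "\<not> graph_iso (K_minus_plus_isolated a b (p - 2)) (K_plus p q)"
    using K[OF ab] .
  fix G
  assume "simple_graph G" "cospectral G (K_plus p q)" "\<not> graph_iso G (K_plus p q)"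
  then obtain c d where cd: "c + d + 2 = q + 3" "(c + 1) * (d + 1) = p * q + 2"
    and iso: "graph_iso G (K_minus_plus_isolated (c + 1) (d + 1) (p - 2))"
      "graph_iso G (K_minus_plus_isolated (d + 1) (c + 1) (p - 2))"
    using cospectral_K_plus_imp[OF assms] by blast
  have "int a + int b = int (c + 1) + int (d + 1)" using ab cd by linarith
  moreover have "int a * int b = int (c + 1) * int (d + 1)"
    using ab cd by (metis of_nat_mult)
  \<comment> \<open>Sum and product determine an unordered pair; working in \<open>int\<close>
    avoids truncated subtraction.\<close>
  moreover have "(x - u) * (x - v) = 0" if "x + y = u + v" "x * y = u * v" for x y u v :: int
  proof -
    have y: "u + v - x = y" using that(1) by simp
    have "x * (u + v - x) = u * v" unfolding y by (rule that(2))
    then show ?thesis by (simp add: algebra_simps)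
  qed
  ultimately have "(int a - int (c + 1)) * (int a - int (d + 1)) = 0" by blast
  then have "a = c + 1 \<or> a = d + 1" by auto
  then have "a = c + 1 \<and> b = d + 1 \<or> a = d + 1 \<and> b = c + 1" using ab cd by linarith
  then show "graph_iso G (K_minus_plus_isolated a b (p - 2))" using iso by blast
qed

end
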